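(* Let $0<q<1$, fix a square root $q^{1/2}$ of $q$ (and write $q^{k/2}=(q^{1/2})^k$ for $k\in\mathbb Z$), and let $g,b,c\in\mathbb C\setminus\{0\}$ with $c=\overline{b}$ and $\Re(g)=0$ (so $\overline g=-g$ and $g^2<0$). Assume that $b$, $c$, $g^2/b$, $g^2/c$ are not of the form $q^j$ with $j\in\mathbb Z$. For $n,k\in\mathbb Z$ put $$F_{n,k}(g,b,c\,|q):=\frac{(1-gq^k)}{(1-g)}\,\frac{(b;q)_{n+k}\,(g^2/c;q)_{k-n}}{(cq;q)_{n+k}\,(g^2q/b;q)_{k-n}}\,q^{\frac k2},$$ and for $|z|=1$ let $$F_n=F_n(z;g,b,c\,|q):=\sum_{k\in\mathbb Z}F_{n,k}(g,b,c\,|q)\,z^k .$$ Then $(F_n)_{n\in\mathbb Z}$ is an infinite family of orthogonal functions on the unit circle with respect to the weight function $w(z)=1$, with squared norm evaluation $$h_n=\frac{(q,q,g^2q,q/g^2,g^2q/bc,bcq/g^2,cq/b,bq/c;q)_\infty}{(g^2q/b,bq/g^2,g^2q/c,cq/g^2,bq,q/b,cq,q/c;q)_\infty}\;\frac{(1-bc/g^2)}{(1-bcq^{2n}/g^2)}\,q^n .$$ That is, for all $n,m\in\mathbb Z$, $$\frac1{2\pi\mathrm i}\int_{|z|=1}F_n(z;g,b,c\,|q)\,\overline{F_m(z;g,b,c\,|q)}\,\frac{\mathrm dz}{z}=h_n\,\delta_{n,m},$$ where each $h_n$ is a positive real number.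
   Context: For $a\in\mathbb C$ and $k\in\mathbb Z$: $(a;q)_\infty=\prod_{j\ge0}(1-aq^j)$ and $(a;q)_k=(a;q)_\infty/(aq^k;q)_\infty$ (so $(a;q)_k=\prod_{j=0}^{k-1}(1-aq^j)$ for $k\ge0$ and $(a;q)_{-k}=1/\prod_{j=1}^{k}(1-aq^{-j})$ for $k\geq 1$). Also $(a_1,\dots,a_m;q)_\infty=(a_1;q)_\infty\cdots(a_m;q)_\infty$. In expressions such as $g^2q/bc$ the denominator is the product $bc$. For complex-valued functions $f,g$ on the unit circle $|z|=1$ and a positive weight $w$, the inner product is $\langle f,g\rangle=\frac1{2\pi\mathrm i}\int_{|z|=1}f(z)\overline{g(z)}\,w(z)\frac{\mathrm dz}{z}$. A sequence $(f_n)_n$ is a family of orthogonal functions (with respect to $w$) if $\langle f_n,f_m\rangle=h_n\delta_{n,m}$ for some sequence of positive real numbers $(h_n)_n$ (the squared norms). *)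

theory Defs
  imports "HOL-Complex_Analysis.Complex_Analysis"
begin

definition qpoch_inf :: "complex \<Rightarrow> real \<Rightarrow> complex" where
  "qpoch_inf a q = (\<Prod>j. 1 - a * complex_of_real (q ^ j))"

definition qpoch :: "complex \<Rightarrow> real \<Rightarrow> int \<Rightarrow> complex" where
  "qpoch a q k = qpoch_inf a q / qpoch_inf (a * complex_of_real (q powi k)) q"

definition qpoch_inf_list :: "complex list \<Rightarrow> real \<Rightarrow> complex" where
  "qpoch_inf_list as q = (\<Prod>a\<leftarrow>as. qpoch_inf a q)"

definition circle_integrand ::
    "(complex \<Rightarrow> real) \<Rightarrow> (complex \<Rightarrow> complex) \<Rightarrow> (complex \<Rightarrow> complex) \<Rightarrow> complex \<Rightarrow> complex" where
  "circle_integrand w f g z = f z * cnj (g z) * complex_of_real (w z) / z"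

definition circle_inner ::
    "(complex \<Rightarrow> real) \<Rightarrow> (complex \<Rightarrow> complex) \<Rightarrow> (complex \<Rightarrow> complex) \<Rightarrow> complex" where
  "circle_inner w f g =
     1 / (2 * complex_of_real pi * \<i>) * contour_integral (circlepath 0 1) (circle_integrand w f g)"

text \<open>
  Since \<^const>\<open>contour_integral\<close> is total, integrability is demanded explicitly.
\<close>

definition orthogonal_functions ::
    "(complex \<Rightarrow> real) \<Rightarrow> (int \<Rightarrow> complex \<Rightarrow> complex) \<Rightarrow> (int \<Rightarrow> real) \<Rightarrow> bool" where
  "orthogonal_functions w f h \<longleftrightarrow>
     (\<forall>n. 0 < h n) \<and>
     (\<forall>n m. circle_integrand w (f n) (f m) contour_integrable_on circlepath 0 1 \<and>
            circle_inner w (f n) (f m) = (if n = m then complex_of_real (h n) else 0))"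

text \<open>In the following, \<open>r\<close> is the chosen square root of \<open>q\<close>.\<close>

definition F_coeff ::
    "real \<Rightarrow> complex \<Rightarrow> complex \<Rightarrow> complex \<Rightarrow> complex \<Rightarrow> int \<Rightarrow> int \<Rightarrow> complex" where
  "F_coeff q r g b c n k =
     (1 - g * complex_of_real (q powi k)) / (1 - g) *
     ((qpoch b q (n + k) * qpoch (g\<^sup>2 / c) q (k - n)) /
      (qpoch (c * complex_of_real q) q (n + k) * qpoch (g\<^sup>2 * complex_of_real q / b) q (k - n))) *
     r powi k"

definition F_fun ::
    "real \<Rightarrow> complex \<Rightarrow> complex \<Rightarrow> complex \<Rightarrow> complex \<Rightarrow> int \<Rightarrow> complex \<Rightarrow> complex" where
  "F_fun q r g b c n z = (\<Sum>\<^sub>\<infinity>k. F_coeff q r g b c n k * z powi k)"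

definition F_norm :: "real \<Rightarrow> complex \<Rightarrow> complex \<Rightarrow> complex \<Rightarrow> int \<Rightarrow> complex" where
  "F_norm q g b c n =
     (let Q = complex_of_real q in
       qpoch_inf_list
         [Q, Q, g\<^sup>2 * Q, Q / g\<^sup>2, g\<^sup>2 * Q / (b * c), b * c * Q / g\<^sup>2, c * Q / b, b * Q / c] q /
       qpoch_inf_list
         [g\<^sup>2 * Q / b, b * Q / g\<^sup>2, g\<^sup>2 * Q / c, c * Q / g\<^sup>2, b * Q, Q / b, c * Q, Q / c] q *
       ((1 - b * c / g\<^sup>2) / (1 - b * c * Q powi (2 * n) / g\<^sup>2)) *
       Q powi n)"

end

theory Submission
  imports Defs
begin

text \<open>
  By Parseval the inner product of \<open>F\<^sub>n\<close> and \<open>F\<^sub>m\<close> is \<open>\<Sum>\<^sub>k F\<^sub>n\<^sub>,\<^sub>k cnj F\<^sub>m\<^sub>,\<^sub>k\<close>.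
  Put \<open>a = g\<^sup>2\<close>, \<open>x = q\<^sup>k\<close> and \<open>\<sigma> t = t + a / t\<close>. Up to a constant the summand is
  \<open>(1/x - a x) R (\<sigma> (1/x))\<close> with a rational function \<open>R\<close> whose denominator has the zeros
  \<open>\<sigma> (c q\<^sup>i)\<close> for \<open>m \<le> i \<le> n\<close> (if \<open>m < n\<close>), or \<open>\<sigma> (c q\<^sup>n)\<close> and \<open>\<sigma> (b q\<^sup>n)\<close> (if \<open>m = n\<close>).
  The rational function \<open>\<Prod>\<^sub>j (v - \<sigma> (\<beta> q\<^sup>-\<^sup>j)) / (v - \<sigma> (q\<^sup>-\<^sup>j))\<close> with \<open>\<bar>j\<bar> \<le> N\<close> and \<open>\<beta> = c q\<^sup>m\<close>
  has at the pole \<open>\<sigma> (q\<^sup>-\<^sup>k)\<close> the residue \<open>1/x - a x\<close>, up to a factor that is bounded and tends to a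
  constant independent of \<open>k\<close> as \<open>N\<close> grows. Multiplying it by \<open>R\<close> and summing residues
  (Lagrange interpolation) gives \<open>0\<close> if \<open>m < n\<close>, since the numerator cancels all zeros of the
  denominator of \<open>R\<close> and the degrees differ by two; if \<open>m = n\<close>, only the pole at
  \<open>\<sigma> (b q\<^sup>n)\<close> remains and yields the product formula. Tannery's theorem justifies the limit.
  The sum is the special case \<open>be = a q\<^sup>N\<close>, \<open>cd = a q\<^sup>-\<^sup>N\<close> of Bailey's \<open>6\<psi>6\<close>.
\<close>

section \<open>Lagrange interpolation and interchange of limits\<close>

text \<open>Dominated convergence for unordered sums: the M-test makes the finite partial sums
  converge uniformly in \<open>N\<close>, so the limit over finite sets and the limit in
  \<open>N\<close> may be exchanged.\<close>

lemma tannery_infsum: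
  fixes f :: "'a \<Rightarrow> nat \<Rightarrow> 'b :: banach"
  assumes lim: "\<And>k. (\<lambda>N. f k N) \<longlonglongrightarrow> l k"
    and bound: "\<And>k N. norm (f k N) \<le> M k"
    and summable: "M summable_on UNIV"
  shows "(\<lambda>N. \<Sum>\<^sub>\<infinity>k. f k N) \<longlonglongrightarrow> (\<Sum>\<^sub>\<infinity>k. l k)"
proof (rule swap_uniform_limit')
  show "\<forall>\<^sub>F X in finite_subsets_at_top UNIV. ((\<lambda>N. \<Sum>k\<in>X. f k N) \<longlongrightarrow> (\<Sum>k\<in>X. l k)) sequentially"
    by (intro always_eventually allI tendsto_sum lim)
  have "norm (l k) \<le> M k" for k
    using tendsto_norm[OF lim[of k]] bound[of k] by (intro tendsto_upperbound) auto
  hence "(\<lambda>k. norm (l k)) summable_on UNIV"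
    by (intro summable_on_comparison_test[OF summable]) auto
  hence "(l has_sum (\<Sum>\<^sub>\<infinity>k. l k)) UNIV"
    by (metis abs_summable_summable has_sum_infsum)
  thus "((\<lambda>X. \<Sum>k\<in>X. l k) \<longlongrightarrow> (\<Sum>\<^sub>\<infinity>k. l k)) (finite_subsets_at_top UNIV)"
    by (simp add: has_sum_def)
  show "uniform_limit UNIV (\<lambda>X N. \<Sum>k\<in>X. f k N) (\<lambda>N. \<Sum>\<^sub>\<infinity>k. f k N) (finite_subsets_at_top UNIV)"
    by (rule Weierstrass_m_test_general[OF bound summable])
qed auto

text \<open>Both sides have degree below the number of nodes and agree at every node.\<close>

lemma lagrange_interpolation:
  fixes v :: "'a \<Rightarrow> 'b :: field"
  assumes "finite I" "inj_on v I" "degree p < card I"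
  shows "p = (\<Sum>k\<in>I. smult (poly p (v k) / (\<Prod>j\<in>I-{k}. v k - v j)) (\<Prod>j\<in>I-{k}. [:- v j, 1:]))"
    (is "_ = ?P")
proof (rule poly_eqI_degree[where A = "v ` I"])
  have card: "card (v ` I) = card I" using assms(2) by (rule card_image)
  show "degree p < card (v ` I)" using assms(3) card by simp
  have "degree ?P \<le> card I - 1"
  proof (rule degree_sum_le[OF assms(1)])
    fix k assume k: "k \<in> I"
    have "degree (\<Prod>j\<in>I-{k}. [:- v j, 1:]) = (\<Sum>j\<in>I-{k}. degree [:- v j, 1:])"
      by (rule degree_prod_eq_sum_degree) auto
    also have "\<dots> = card I - 1" using k assms(1) by simp
    finally show "degree (smult (poly p (v k) / (\<Prod>j\<in>I-{k}. v k - v j)) (\<Prod>j\<in>I-{k}. [:- v j, 1:])) \<le> card I - 1"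
      by (metis degree_smult_le)
  qed
  thus "degree ?P < card (v ` I)" using assms(3) card by linarith
next
  fix x assume "x \<in> v ` I"
  then obtain i where i: "i \<in> I" "x = v i" by auto
  have z: "(\<Prod>j\<in>I-{i}. v i - v j) \<noteq> 0"
    using assms(1,2) i by (auto simp: inj_on_def)
  have "poly ?P x = (\<Sum>k\<in>I. poly p (v k) / (\<Prod>j\<in>I-{k}. v k - v j) * (\<Prod>j\<in>I-{k}. v i - v j))"
    by (simp add: poly_sum poly_prod i)
  also have "\<dots> = (\<Sum>k\<in>I. if k = i then poly p (v i) else 0)"
  proof (rule sum.cong)
    fix k assume k: "k \<in> I"
    show "poly p (v k) / (\<Prod>j\<in>I-{k}. v k - v j) * (\<Prod>j\<in>I-{k}. v i - v j) = (if k = i then poly p (v i) else 0)"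
    proof (cases "k = i")
      case False
      hence "(\<Prod>j\<in>I-{k}. v i - v j) = 0" using i assms(1) by (intro prod_zero) auto
      thus ?thesis using False by simp
    qed (use z in simp)
  qed auto
  also have "\<dots> = poly p x" using i assms(1) by simp
  finally show "poly p x = poly ?P x" ..
qed

text \<open>The interpolation formula evaluated at \<open>x\<close> and divided by the node
  polynomial. It serves the squared norm, where one pole besides the nodes survives.\<close>

lemma lagrange_partial_fractions:
  fixes v :: "'a \<Rightarrow> 'b :: field"
  assumes "finite I" "inj_on v I" "degree p < card I" "x \<notin> v ` I"
  shows "(\<Sum>k\<in>I. poly p (v k) / (\<Prod>j\<in>I-{k}. v k - v j) / (x - v k)) = poly p x / (\<Prod>j\<in>I. x - v j)"
proof -
  have "poly p x = (\<Sum>k\<in>I. poly p (v k) / (\<Prod>j\<in>I-{k}. v k - v j) * (\<Prod>j\<in>I-{k}. x - v j))"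
    by (subst lagrange_interpolation[OF assms(1-3)]) (simp add: poly_sum poly_prod)
  also have "\<dots> / (\<Prod>j\<in>I. x - v j) = (\<Sum>k\<in>I. poly p (v k) / (\<Prod>j\<in>I-{k}. v k - v j) / (x - v k))"
    unfolding sum_divide_distrib
  proof (rule sum.cong)
    fix k assume k: "k \<in> I"
    have "(\<Prod>j\<in>I. x - v j) = (x - v k) * (\<Prod>j\<in>I-{k}. x - v j)"
      using k assms(1) by (simp add: prod.remove)
    moreover have "(\<Prod>j\<in>I-{k}. x - v j) \<noteq> 0" "x - v k \<noteq> 0"
      using assms k by auto
    ultimately show "poly p (v k) / (\<Prod>j\<in>I-{k}. v k - v j) * (\<Prod>j\<in>I-{k}. x - v j) / (\<Prod>j\<in>I. x - v j)
      = poly p (v k) / (\<Prod>j\<in>I-{k}. v k - v j) / (x - v k)"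
      by simp
  qed auto
  finally show ?thesis ..
qed

text \<open>Compares the coefficients of degree \<open>card I - 1\<close> in the interpolation
  formula: each product of linear factors is monic of this degree, while \<open>p\<close> has a
  smaller one. In terms of residues, a degree gap of two leaves nothing at infinity.\<close>

lemma lagrange_sum_eq_0:
  fixes v :: "'a \<Rightarrow> 'b :: field"
  assumes "finite I" "inj_on v I" "degree p + 1 < card I"
  shows "(\<Sum>k\<in>I. poly p (v k) / (\<Prod>j\<in>I-{k}. v k - v j)) = 0"
proof -
  have c: "coeff (\<Prod>j\<in>I-{k}. [:- v j, 1:]) (card I - 1) = 1" if "k \<in> I" for k
  proof -
    have "degree (\<Prod>j\<in>I-{k}. [:- v j, 1:]) = (\<Sum>j\<in>I-{k}. degree [:- v j, 1:])"
      by (rule degree_prod_eq_sum_degree) auto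
    also have "\<dots> = card I - 1" using that assms(1) by simp
    finally have "coeff (\<Prod>j\<in>I-{k}. [:- v j, 1:]) (card I - 1) = lead_coeff (\<Prod>j\<in>I-{k}. [:- v j, 1:])" by simp
    thus ?thesis by (simp add: lead_coeff_prod)
  qed
  have "0 = coeff p (card I - 1)" using assms(3) by (intro coeff_eq_0[symmetric]) auto
  also have "\<dots> = (\<Sum>k\<in>I. poly p (v k) / (\<Prod>j\<in>I-{k}. v k - v j))"
    by (subst lagrange_interpolation[OF assms(1,2)]) (use assms(3) c in \<open>auto simp: coeff_sum\<close>)
  finally show ?thesis ..
qed

section \<open>Fourier series on the unit circle\<close>

text \<open>Every power except \<open>z powi -1\<close> has a primitive off the origin.\<close>

lemma has_contour_integral_powi_circlepath:
  "((\<lambda>z. z powi m) has_contour_integral (if m = -1 then 2 * of_real pi * \<i> else 0)) (circlepath 0 1)"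
proof (cases "m = -1")
  case True
  have "((\<lambda>w. 1 / (w - 0)) has_contour_integral 2 * of_real pi * \<i>) (circlepath 0 1)"
    using Cauchy_integral_circlepath_simple[of "\<lambda>_. 1" 0 1 0] by simp
  thus ?thesis using True by (simp add: power_int_minus divide_inverse)
next
  case False
  have "((\<lambda>z. z powi m) has_contour_integral 0) (circlepath 0 1)"
  proof (rule Cauchy_theorem_primitive[where S = "- {0}" and f = "\<lambda>z. z powi (m + 1) / of_int (m + 1)"])
    fix z :: complex assume "z \<in> - {0}"
    hence "((\<lambda>z. z powi (m + 1)) has_field_derivative of_int (m + 1) * z powi m) (at z within - {0})"
      using has_derivative_power_int'[of z "m + 1" "- {0}"]
      by (simp add: has_field_derivative_def mult_commute_abs)
    from DERIV_cdivide[OF this, of "of_int (m + 1)"]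
    show "((\<lambda>z. z powi (m + 1) / of_int (m + 1)) has_field_derivative z powi m) (at z within - {0})"
      using False by (metis (no_types, lifting) add.commute add_eq_0_iff nonzero_mult_div_cancel_left of_int_eq_0_iff)
  qed auto
  thus ?thesis using False by simp
qed

text \<open>Parseval's identity for absolutely summable coefficients: both series converge uniformly
  on the circle, hence so do the truncated integrands, and the integral passes to the limit.\<close>

lemma circle_fourier_inner:
  fixes f g :: "int \<Rightarrow> complex"
  assumes f: "(\<lambda>k. norm (f k)) summable_on UNIV" and g: "(\<lambda>k. norm (g k)) summable_on UNIV"
  defines "F \<equiv> (\<lambda>z. \<Sum>\<^sub>\<infinity>k. f k * z powi k)" and "G \<equiv> (\<lambda>z. \<Sum>\<^sub>\<infinity>k. g k * z powi k)"
  shows "circle_integrand (\<lambda>z. 1) F G contour_integrable_on circlepath 0 1"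
    and "((\<lambda>k. f k * cnj (g k)) has_sum circle_inner (\<lambda>z. 1) F G) UNIV"
proof -
  let ?A = "finite_subsets_at_top (UNIV :: int set)"
  let ?S = "sphere (0::complex) 1"
  have norm: "norm (u k * z powi k) = norm (u k)" if "z \<in> ?S" for u :: "int \<Rightarrow> complex" and k z
    using that by (simp add: norm_mult norm_power_int)
  have lim: "uniform_limit ?S (\<lambda>X z. \<Sum>k\<in>X. u k * z powi k) (\<lambda>z. \<Sum>\<^sub>\<infinity>k. u k * z powi k) ?A"
    and bdd: "bounded ((\<lambda>z. \<Sum>\<^sub>\<infinity>k. u k * z powi k) ` ?S)"
    if u: "(\<lambda>k. norm (u k)) summable_on UNIV" for u :: "int \<Rightarrow> complex"
  proof -
    show "uniform_limit ?S (\<lambda>X z. \<Sum>k\<in>X. u k * z powi k) (\<lambda>z. \<Sum>\<^sub>\<infinity>k. u k * z powi k) ?A"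
      by (rule Weierstrass_m_test_general[OF _ u]) (use norm in auto)
    have "norm (\<Sum>\<^sub>\<infinity>k. u k * z powi k) \<le> (\<Sum>\<^sub>\<infinity>k. norm (u k))" if z: "z \<in> ?S" for z
      using norm_infsum_bound[of "\<lambda>k. u k * z powi k" UNIV] u norm[OF z, of u] by simp
    thus "bounded ((\<lambda>z. \<Sum>\<^sub>\<infinity>k. u k * z powi k) ` ?S)"
      unfolding bounded_iff by blast
  qed
  have cnj_powi: "cnj (z powi k) = z powi (-k)" if "z \<in> ?S" for z k
  proof -
    have "cnj z = inverse z"
      using that complex_norm_square[of z] by (intro inverse_unique[symmetric]) simp
    thus ?thesis by (simp add: power_int_inverse power_int_minus)
  qed
  have limG: "uniform_limit ?S (\<lambda>X z. cnj (\<Sum>k\<in>X. g k * z powi k)) (\<lambda>z. cnj (G z)) ?A"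
    unfolding uniform_limit_iff
  proof (intro allI impI)
    fix e :: real assume "e > 0"
    from uniform_limitD[OF lim[OF g] this]
    show "\<forall>\<^sub>F X in ?A. \<forall>z\<in>?S. dist (cnj (\<Sum>k\<in>X. g k * z powi k)) (cnj (G z)) < e"
      by (simp only: G_def dist_norm complex_cnj_diff[symmetric] complex_mod_cnj)
  qed
  have bddG: "bounded ((\<lambda>z. cnj (G z)) ` ?S)"
    using bdd[OF g] by (simp add: bounded_iff G_def)
  have bddF: "bounded (F ` ?S)" using bdd[OF f] by (simp add: F_def)
  have "uniform_limit ?S (\<lambda>X z. (\<Sum>k\<in>X. f k * z powi k) * cnj (\<Sum>k\<in>X. g k * z powi k)) (\<lambda>z. F z * cnj (G z)) ?A"
    using lim[OF f] limG bddF bddG unfolding F_def by (rule uniform_lim_mult)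
  moreover have "bounded ((\<lambda>z. F z * cnj (G z)) ` ?S)"
  proof -
    obtain C D where "\<And>z. z \<in> ?S \<Longrightarrow> norm (F z) \<le> C" "\<And>z. z \<in> ?S \<Longrightarrow> norm (cnj (G z)) \<le> D"
      using bddF bddG unfolding bounded_iff by (metis imageI)
    hence "norm (F z * cnj (G z)) \<le> C * D" if "z \<in> ?S" for z
      unfolding norm_mult using that by (intro mult_mono) (auto intro: order_trans[OF norm_ge_zero])
    thus ?thesis unfolding bounded_iff by blast
  qed
  moreover have "bounded (inverse ` ?S)"
    by (auto simp: bounded_iff norm_inverse)
  ultimately have "uniform_limit ?S (\<lambda>X z. (\<Sum>k\<in>X. f k * z powi k) * cnj (\<Sum>k\<in>X. g k * z powi k) * inverse z)
      (\<lambda>z. F z * cnj (G z) * inverse z) ?A"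
    using uniform_lim_mult[OF _ uniform_limit_const] by blast
  hence ul: "uniform_limit ?S (\<lambda>X z. (\<Sum>k\<in>X. f k * z powi k) * cnj (\<Sum>k\<in>X. g k * z powi k) * inverse z)
      (circle_integrand (\<lambda>z. 1) F G) ?A"
    by (simp add: circle_integrand_def[abs_def] divide_inverse)
  \<comment> \<open>Both series are truncated to the same \<open>X\<close>; in the double sum the
    exponent \<open>k - l - 1\<close> is -1 exactly on the diagonal.\<close>
  have part: "((\<lambda>z. (\<Sum>k\<in>X. f k * z powi k) * cnj (\<Sum>k\<in>X. g k * z powi k) * inverse z) has_contour_integral
     2 * of_real pi * \<i> * (\<Sum>k\<in>X. f k * cnj (g k))) (circlepath 0 1)" if X: "finite X" for X
  proof -
    have "((\<lambda>z. \<Sum>k\<in>X. \<Sum>l\<in>X. f k * cnj (g l) * z powi (k - l - 1)) has_contour_integral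
      (\<Sum>k\<in>X. \<Sum>l\<in>X. f k * cnj (g l) * (if k - l - 1 = -1 then 2 * of_real pi * \<i> else 0))) (circlepath 0 1)"
      by (intro has_contour_integral_sum X has_contour_integral_lmul has_contour_integral_powi_circlepath)
    also have "(\<Sum>k\<in>X. \<Sum>l\<in>X. f k * cnj (g l) * (if k - l - 1 = -1 then 2 * of_real pi * \<i> else 0))
       = (\<Sum>k\<in>X. \<Sum>l\<in>X. if k = l then 2 * of_real pi * \<i> * (f k * cnj (g l)) else 0)"
      by (intro sum.cong) auto
    also have "\<dots> = 2 * of_real pi * \<i> * (\<Sum>k\<in>X. f k * cnj (g k))"
      using X by (simp add: sum_distrib_left)
    finally show ?thesis
    proof (rule has_contour_integral_eq)
      fix z assume "z \<in> path_image (circlepath 0 1)"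
      hence z: "z \<in> ?S" by simp
      hence z0: "z \<noteq> 0" by auto
      have "z powi (k - l - 1) = z powi k * z powi (-l) * inverse z" for k l
        using z0 by (simp add: power_int_diff power_int_minus divide_inverse)
      thus "(\<Sum>k\<in>X. \<Sum>l\<in>X. f k * cnj (g l) * z powi (k - l - 1)) =
        (\<Sum>k\<in>X. f k * z powi k) * cnj (\<Sum>k\<in>X. g k * z powi k) * inverse z"
        unfolding cnj_sum complex_cnj_mult cnj_powi[OF z] sum_product
        by (simp add: sum_distrib_left mult_ac)
    qed
  qed
  have ev: "\<forall>\<^sub>F X in ?A. (\<lambda>z. (\<Sum>k\<in>X. f k * z powi k) * cnj (\<Sum>k\<in>X. g k * z powi k) * inverse z)
     contour_integrable_on circlepath 0 1"
    unfolding contour_integrable_on_def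
    by (rule eventually_mono[OF eventually_finite_subsets_at_top_weakI[of UNIV finite]]) (use part in auto)
  note res = contour_integral_uniform_limit_circlepath[OF ev ul _ zero_less_one]
  show "circle_integrand (\<lambda>z. 1) F G contour_integrable_on circlepath 0 1"
    by (rule res(1)) simp
  have "((\<lambda>X. 2 * of_real pi * \<i> * (\<Sum>k\<in>X. f k * cnj (g k))) \<longlongrightarrow>
     contour_integral (circlepath 0 1) (circle_integrand (\<lambda>z. 1) F G)) ?A"
  proof (rule Lim_transform_eventually[OF res(2)])
    show "\<forall>\<^sub>F X in ?A. contour_integral (circlepath 0 1)
       (\<lambda>z. (\<Sum>k\<in>X. f k * z powi k) * cnj (\<Sum>k\<in>X. g k * z powi k) * inverse z) =
       2 * of_real pi * \<i> * (\<Sum>k\<in>X. f k * cnj (g k))"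
      by (rule eventually_finite_subsets_at_top_weakI) (use part contour_integral_unique in blast)
  qed simp
  hence "((\<lambda>X. 1 / (2 * complex_of_real pi * \<i>) * (2 * of_real pi * \<i> * (\<Sum>k\<in>X. f k * cnj (g k)))) \<longlongrightarrow>
     circle_inner (\<lambda>z. 1) F G) ?A"
    unfolding circle_inner_def by (rule tendsto_mult_left)
  thus "((\<lambda>k. f k * cnj (g k)) has_sum circle_inner (\<lambda>z. 1) F G) UNIV"
    by (simp add: has_sum_def)
qed

section \<open>Infinite products\<close>

locale nome =
  fixes q :: real
  assumes q_pos: "0 < q" and q_less_1: "q < 1"
begin

abbreviation Q :: complex where "Q \<equiv> complex_of_real q"

lemma q_nonzero [simp]: "q \<noteq> 0"
  using q_pos by simp

lemma Q_nonzero: "Q \<noteq> 0"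
  using q_pos by simp

lemma Q_powi_nonzero [simp]: "Q powi k \<noteq> 0"
  by simp

lemma norm_Q_powi [simp]: "norm (Q powi k) = q powi k"
  using q_pos by (simp add: norm_power_int)

lemma Q_powi_add: "Q powi (m + n) = Q powi m * Q powi n"
  using Q_nonzero by (intro power_int_add) auto

lemma Q_powi_eq_1_iff: "Q powi k = 1 \<longleftrightarrow> k = 0"
proof
  assume "Q powi k = 1"
  hence "q powi k = 1" by (metis norm_Q_powi norm_one)
  thus "k = 0"
    using q_pos q_less_1 power_int_strict_decreasing[of k 0 q] power_int_strict_decreasing[of 0 k q]
    by (cases k "0::int" rule: linorder_cases) auto
qed simp

section \<open>Convergence, zeros and shifts of \<open>qpoch_inf\<close>\<close>

lemma qpoch_inf_convergent: "convergent_prod (\<lambda>j. 1 - a * complex_of_real (q ^ j))"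
proof -
  have "summable (\<lambda>j. norm a * q ^ j)"
    using q_pos q_less_1 by (intro summable_mult summable_geometric) auto
  hence "summable (\<lambda>j. norm (1 - a * complex_of_real (q ^ j) - 1))"
    using q_pos by (simp add: norm_mult norm_power)
  thus ?thesis
    by (intro abs_convergent_prod_imp_convergent_prod summable_imp_abs_convergent_prod)
qed

lemma qpoch_inf_tendsto: "(\<lambda>n. \<Prod>j<n. 1 - a * Q ^ j) \<longlonglongrightarrow> qpoch_inf a q"
  using convergent_prod_LIMSEQ[OF qpoch_inf_convergent[of a]]
  by (simp add: qpoch_inf_def LIMSEQ_lessThan_iff_atMost)

lemma qpoch_inf_nonzero:
  assumes "\<And>j::nat. a * Q powi j \<noteq> 1"
  shows "qpoch_inf a q \<noteq> 0"
  unfolding qpoch_inf_def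
proof (rule prodinf_nonzero[OF qpoch_inf_convergent])
  fix i show "1 - a * complex_of_real (q ^ i) \<noteq> 0"
    using assms[of i] by auto
qed

lemma Q_times_Q_powi: "Q * Q powi int j = Q powi int (Suc j)"
  by (simp add: power_int_add)

lemma qpoch_inf_powi_nonzero:
  assumes "\<And>k. t * Q powi k \<noteq> 1"
  shows "qpoch_inf (t * Q powi m) q \<noteq> 0"
proof (rule qpoch_inf_nonzero)
  fix j show "t * Q powi m * Q powi int j \<noteq> 1"
    using assms[of "m + int j"] by (simp add: Q_powi_add mult_ac)
qed

lemma generic_inverse:
  assumes "\<And>k. t * Q powi k \<noteq> 1"
  shows "1 / t * Q powi k \<noteq> 1"
proof
  assume "1 / t * Q powi k = 1"
  hence "t * Q powi (- k) = 1"
    by (auto simp: power_int_minus field_simps split: if_splits)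
  thus False using assms by blast
qed

lemma qpoch_inf_rec: "qpoch_inf a q = (1 - a) * qpoch_inf (a * Q) q"
proof (rule LIMSEQ_unique)
  show "(\<lambda>n. \<Prod>j<Suc n. 1 - a * Q ^ j) \<longlonglongrightarrow> qpoch_inf a q"
    using qpoch_inf_tendsto by (rule LIMSEQ_Suc)
  have "(\<Prod>j<Suc n. 1 - a * Q ^ j) = (1 - a) * (\<Prod>j<n. 1 - a * Q * Q ^ j)" for n
    by (subst prod.lessThan_Suc_shift) (simp add: mult_ac)
  thus "(\<lambda>n. \<Prod>j<Suc n. 1 - a * Q ^ j) \<longlonglongrightarrow> (1 - a) * qpoch_inf (a * Q) q"
    by (simp only:) (intro tendsto_intros qpoch_inf_tendsto)
qed

lemma qpoch_inf_shift: "qpoch_inf a q = (\<Prod>i<n. 1 - a * Q ^ i) * qpoch_inf (a * Q ^ n) q"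
proof (induction n)
  case (Suc n)
  thus ?case using qpoch_inf_rec[of "a * Q ^ n"] by (simp add: mult_ac)
qed simp

lemma cnj_qpoch_inf: "cnj (qpoch_inf a q) = qpoch_inf (cnj a) q"
proof (rule LIMSEQ_unique)
  show "(\<lambda>n. \<Prod>j<n. 1 - cnj a * Q ^ j) \<longlonglongrightarrow> cnj (qpoch_inf a q)"
    using tendsto_cnj[OF qpoch_inf_tendsto[of a]] by simp
qed (rule qpoch_inf_tendsto)

section \<open>Bilateral products for quotients of theta functions\<close>

lemma prod_bilateral_split:
  fixes F :: "int \<Rightarrow> complex"
  shows "(\<Prod>i\<in>{-int m..int n}-{0}. F i) = (\<Prod>j<n. F (int (Suc j))) * (\<Prod>j<m. F (- int (Suc j)))"
proof -
  have inj: "inj_on (\<lambda>j. int (Suc j)) {..<n}" "inj_on (\<lambda>j. - int (Suc j)) {..<m}"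
    by (auto simp: inj_on_def)
  have "{-int m..int n}-{0} = (\<lambda>j. int (Suc j)) ` {..<n} \<union> (\<lambda>j. - int (Suc j)) ` {..<m}"
  proof (intro equalityI subsetI)
    fix i assume i: "i \<in> {-int m..int n}-{0}"
    show "i \<in> (\<lambda>j. int (Suc j)) ` {..<n} \<union> (\<lambda>j. - int (Suc j)) ` {..<m}"
    proof (cases "i > 0")
      case True
      hence "i = int (Suc (nat (i - 1)))" "nat (i - 1) < n" using i by auto
      thus ?thesis by blast
    next
      case False
      hence "i = - int (Suc (nat (- i - 1)))" "nat (- i - 1) < m" using i by auto
      thus ?thesis by blast
    qed
  qed auto
  also have "prod F \<dots> = prod F ((\<lambda>j. int (Suc j)) ` {..<n}) * prod F ((\<lambda>j. - int (Suc j)) ` {..<m})"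
    by (rule prod.union_disjoint) auto
  also have "\<dots> = (\<Prod>j<n. F (int (Suc j))) * (\<Prod>j<m. F (- int (Suc j)))"
    by (simp only: prod.reindex[OF inj(1)] prod.reindex[OF inj(2)] o_def)
  finally show ?thesis .
qed

text \<open>One factor of a bilateral product for \<theta>(s) \<theta>(t) / (\<theta>(u)
  \<theta>(v)), where \<theta>(x) = (x, q/x; q)_inf. As \<open>i\<close> decreases it tends to
  st/(uv), so convergence calls for st = uv. The products leave out index 0, whose denominator
  vanishes for u = 1.\<close>

definition theta_quot :: "complex \<Rightarrow> complex \<Rightarrow> complex \<Rightarrow> complex \<Rightarrow> int \<Rightarrow> complex" where
  "theta_quot s t u v i =
     (1 - s * Q powi i) * (1 - t * Q powi i) / ((1 - u * Q powi i) * (1 - v * Q powi i))"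

text \<open>Pulling \<open>- x * Q powi (- i)\<close> out of each of the four factors leaves the
  quotient st/(uv), which is 1.\<close>

lemma theta_quot_minus:
  assumes "s \<noteq> 0" "t \<noteq> 0" "u \<noteq> 0" "v \<noteq> 0" "s * t = u * v"
  shows "theta_quot s t u v (- i) = theta_quot (1/s) (1/t) (1/u) (1/v) i"
proof -
  have *: "1 - x * Q powi (-i) = - x * Q powi (-i) * (1 - 1 / x * Q powi i)" if "x \<noteq> 0" for x
  proof -
    have "1 - x * inverse y = - x * inverse y * (1 - 1 / x * y)" if "y \<noteq> 0" for y
      using that \<open>x \<noteq> 0\<close> by (simp add: right_diff_distrib)
    from this[OF Q_powi_nonzero[of i]] show ?thesis by (simp only: power_int_minus)
  qed
  have "theta_quot s t u v (- i) =
     (s * t * Q powi (-i) * Q powi (-i) * ((1 - 1 / s * Q powi i) * (1 - 1 / t * Q powi i))) /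
     (u * v * Q powi (-i) * Q powi (-i) * ((1 - 1 / u * Q powi i) * (1 - 1 / v * Q powi i)))"
    unfolding theta_quot_def *[OF assms(1)] *[OF assms(2)] *[OF assms(3)] *[OF assms(4)]
    by (simp add: mult_ac)
  also have "\<dots> = theta_quot (1/s) (1/t) (1/u) (1/v) i"
    unfolding assms(5) theta_quot_def using assms(3,4)
    by (subst mult_divide_mult_cancel_left) (auto)
  finally show ?thesis .
qed

lemma theta_quot_half_tendsto:
  assumes "qpoch_inf (u * Q) q \<noteq> 0" "qpoch_inf (v * Q) q \<noteq> 0"
  shows "(\<lambda>n. \<Prod>j<n. theta_quot s t u v (int (Suc j))) \<longlonglongrightarrow>
     qpoch_inf (s * Q) q * qpoch_inf (t * Q) q / (qpoch_inf (u * Q) q * qpoch_inf (v * Q) q)"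
proof -
  have *: "x * Q powi (1 + int j) = x * Q * Q ^ j" for x j
    by (simp add: power_int_add)
  have "(\<lambda>n. (\<Prod>j<n. 1 - s * Q * Q ^ j) * (\<Prod>j<n. 1 - t * Q * Q ^ j) /
     ((\<Prod>j<n. 1 - u * Q * Q ^ j) * (\<Prod>j<n. 1 - v * Q * Q ^ j))) \<longlonglongrightarrow>
     qpoch_inf (s * Q) q * qpoch_inf (t * Q) q / (qpoch_inf (u * Q) q * qpoch_inf (v * Q) q)"
    by (intro tendsto_intros qpoch_inf_tendsto) (use assms in auto)
  thus ?thesis by (simp add: theta_quot_def prod.distrib prod_dividef *)
qed

text \<open>Each half converges on its own, so the two ends of the range may grow independently.
  This covers windows that are not centred at 0.\<close>

lemma theta_quot_bilateral_tendsto: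
  assumes nz: "s \<noteq> 0" "t \<noteq> 0" "u \<noteq> 0" "v \<noteq> 0" and bal: "s * t = u * v"
    and den: "qpoch_inf (u * Q) q \<noteq> 0" "qpoch_inf (v * Q) q \<noteq> 0"
      "qpoch_inf (Q / u) q \<noteq> 0" "qpoch_inf (Q / v) q \<noteq> 0"
    and lim: "filterlim m at_top sequentially" "filterlim n at_top sequentially"
  shows "(\<lambda>N. \<Prod>i\<in>{-int (m N)..int (n N)}-{0}. theta_quot s t u v i) \<longlonglongrightarrow>
     qpoch_inf (s * Q) q * qpoch_inf (t * Q) q / (qpoch_inf (u * Q) q * qpoch_inf (v * Q) q) *
     (qpoch_inf (Q / s) q * qpoch_inf (Q / t) q / (qpoch_inf (Q / u) q * qpoch_inf (Q / v) q))"
proof -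
  have "(\<lambda>n. \<Prod>j<n. theta_quot (1/s) (1/t) (1/u) (1/v) (int (Suc j))) \<longlonglongrightarrow>
     qpoch_inf (Q / s) q * qpoch_inf (Q / t) q / (qpoch_inf (Q / u) q * qpoch_inf (Q / v) q)"
    using theta_quot_half_tendsto[of "1/u" "1/v" "1/s" "1/t"] den by simp
  from filterlim_compose[OF this lim(1)]
    filterlim_compose[OF theta_quot_half_tendsto[OF den(1,2), of s t] lim(2)]
  show ?thesis
    unfolding prod_bilateral_split theta_quot_minus[OF nz bal]
    by (intro tendsto_mult)
qed

end

section \<open>Sums over the nodes \<open>q\<^sup>-\<^sup>k + a q\<^sup>k\<close>\<close>

context nome
begin

lemma prod_window_minus:
  fixes h :: "int \<Rightarrow> complex"
  shows "(\<Prod>j\<in>{-N..N}. h (k - j)) = (\<Prod>i\<in>{k-N..k+N}. h i)"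
  by (rule prod.reindex_bij_witness[of _ "\<lambda>i. k - i" "\<lambda>j. k - j"]) auto

lemma prod_window_plus:
  fixes h :: "int \<Rightarrow> complex"
  shows "(\<Prod>j\<in>{-N..N}. h (k + j)) = (\<Prod>i\<in>{k-N..k+N}. h i)"
  by (rule prod.reindex_bij_witness[of _ "\<lambda>i. i - k" "\<lambda>j. k + j"]) auto

lemma prod_window_minus_remove:
  fixes h :: "int \<Rightarrow> complex"
  shows "(\<Prod>j\<in>{-N..N}-{k}. h (k - j)) = (\<Prod>i\<in>{k-N..k+N}-{0}. h i)"
  by (rule prod.reindex_bij_witness[of _ "\<lambda>i. k - i" "\<lambda>j. k - j"]) auto

end

text \<open>The condition on \<open>a\<close> makes the nodes distinct; those on
  \<open>\<beta>\<close> and \<open>a / \<beta>\<close> keep every \<open>node\<close> away from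
  every \<open>zero_node\<close>.\<close>

locale theta_nodes = nome +
  fixes a \<beta> :: complex
  assumes a_nz: "a \<noteq> 0" and beta_nz: "\<beta> \<noteq> 0"
    and a_generic: "\<And>k. a * Q powi k \<noteq> 1"
    and beta_generic: "\<And>k. \<beta> * Q powi k \<noteq> 1"
    and a_over_beta_generic: "\<And>k. a / \<beta> * Q powi k \<noteq> 1"
begin

text \<open>The invariance of \<open>\<sigma>\<close> under the exchange of \<open>t\<close> and
  \<open>a / t\<close> makes \<open>\<sigma> s - \<sigma> t\<close> a product of two simple
  factors.\<close>

definition \<sigma> :: "complex \<Rightarrow> complex" where "\<sigma> t = t + a / t"

definition node :: "int \<Rightarrow> complex" where "node k = \<sigma> (Q powi (- k))"

definition zero_node :: "int \<Rightarrow> complex" where "zero_node k = \<sigma> (\<beta> * Q powi (- k))"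

text \<open>
  With \<open>x = q\<^sup>k\<close>, the residue of \<open>\<Prod>\<^sub>j (v - zero_node j) / (v - node j)\<close> over \<open>\<bar>j\<bar> \<le> N\<close> at \<open>node k\<close>
  is \<open>1/x - a x\<close> times \<open>window N k\<close>. Reflecting \<open>j\<close> in half of the
  factors makes \<open>k\<close> enter only through the range of the product, which gives both the bound and
  the limit.
\<close>

definition window :: "nat \<Rightarrow> int \<Rightarrow> complex" where
  "window N k = (1 - \<beta>) * (1 - a / \<beta>) / (1 - a) *
     (\<Prod>i\<in>{k - int N..k + int N} - {0}. theta_quot \<beta> (a / \<beta>) 1 a i)"

text \<open>The theta quotient \<theta>(\<beta>) \<theta>(a/\<beta>) / ((q;q)_inf^2 \<theta>(a)),
  left in the shape in which \<open>theta_quot_bilateral_tendsto\<close> yields it for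
  \<open>u = 1\<close> and \<open>v = a\<close>.\<close>

definition window_lim :: complex where
  "window_lim = (1 - \<beta>) * (1 - a / \<beta>) / (1 - a) *
     (qpoch_inf (\<beta> * Q) q * qpoch_inf (a / \<beta> * Q) q / (qpoch_inf (1 * Q) q * qpoch_inf (a * Q) q) *
     (qpoch_inf (Q / \<beta>) q * qpoch_inf (Q / (a / \<beta>)) q / (qpoch_inf (Q / 1) q * qpoch_inf (Q / a) q)))"

section \<open>Differences of nodes; limit and bound of the windows\<close>

lemma sigma_diff: "s \<noteq> 0 \<Longrightarrow> t \<noteq> 0 \<Longrightarrow> \<sigma> s - \<sigma> t = s * (1 - t / s) * (1 - a / (s * t))"
  by (simp add: \<sigma>_def field_simps)

lemma node_minus_sigma:
  assumes "t \<noteq> 0"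
  shows "node k - \<sigma> t = Q powi (-k) * ((1 - t * Q powi k) * (1 - a / t * Q powi k))"
  using sigma_diff[of "Q powi (-k)" t] assms by (simp add: node_def power_int_minus field_simps)

lemma node_minus_zero_node:
  "node k - zero_node j = Q powi (-k) * ((1 - \<beta> * Q powi (k - j)) * (1 - a / \<beta> * Q powi (k + j)))"
  using node_minus_sigma[of "\<beta> * Q powi (-j)" k] beta_nz
  by (simp add: zero_node_def Q_powi_add[of k j] Q_powi_add[of k "-j", simplified] mult_ac power_int_minus divide_inverse)

lemma node_minus_node:
  "node k - node j = Q powi (-k) * ((1 - Q powi (k - j)) * (1 - a * Q powi (k + j)))"
  using node_minus_sigma[of "Q powi (-j)" k]
  by (simp add: node_def Q_powi_add[of k j] Q_powi_add[of k "-j", simplified] mult_ac power_int_minus divide_inverse)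

lemma inj_node: "inj node"
proof (rule injI)
  fix j k assume "node k = node j"
  hence "Q powi (k - j) = 1"
    using node_minus_node[of k j] a_generic[of "k + j"] by auto
  thus "k = j" by (simp add: Q_powi_eq_1_iff)
qed

lemma node_minus_zero_node_nz: "node k - zero_node j \<noteq> 0"
  using beta_generic[of "k - j"] a_over_beta_generic[of "k + j"] unfolding node_minus_zero_node by auto

lemma window_eq:
  assumes "k \<in> {-int N..int N}"
  shows "(\<Prod>j\<in>{-int N..int N}. node k - zero_node j) / (\<Prod>j\<in>{-int N..int N}-{k}. node k - node j)
    = (Q powi (-k) - a * Q powi k) * window N k"
proof -
  define I where "I = {-int N..int N}"
  define J where "J = {k - int N..k + int N}"
  have J: "finite J" "0 \<in> J" "2 * k \<in> J" using assms by (auto simp: J_def)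
  have I: "finite I" "k \<in> I" using assms by (auto simp: I_def)
  define H where "H t = (\<Prod>i\<in>J-{0}. 1 - t * Q powi i)" for t
  have H: "(\<Prod>i\<in>J. 1 - t * Q powi i) = (1 - t) * H t" for t
    using J by (simp add: H_def prod.remove[of J 0])
  have H1: "H 1 \<noteq> 0" using J by (auto simp: H_def Q_powi_eq_1_iff)
  have Ha: "H a \<noteq> 0" using J a_generic by (auto simp: H_def)
  have a1: "1 - a \<noteq> 0" using a_generic[of 0] by simp
  have a2: "1 - a * Q powi (2 * k) \<noteq> 0" using a_generic by auto
  have minus: "(\<Prod>j\<in>I. 1 - t * Q powi (k - j)) = (1 - t) * H t" for t
    unfolding H[symmetric] I_def J_def by (rule prod_window_minus)
  have plus: "(\<Prod>j\<in>I. 1 - t * Q powi (k + j)) = (1 - t) * H t" for t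
    unfolding H[symmetric] I_def J_def by (rule prod_window_plus)
  have num: "(\<Prod>j\<in>I. node k - zero_node j) =
     (Q powi (-k)) ^ card I * ((1 - \<beta>) * H \<beta> * ((1 - a / \<beta>) * H (a / \<beta>)))"
    by (simp only: node_minus_zero_node prod.distrib prod_constant minus plus)
  \<comment> \<open>The numerator has one factor more than the denominator, so exactly one
    \<open>Q powi (- k)\<close> survives in the quotient.\<close>
  have c: "(Q powi (-k)) ^ card I = Q powi (-k) * (Q powi (-k)) ^ card (I - {k})"
    by (simp only: card_Suc_Diff1[OF I, symmetric] power_Suc)
  \<comment> \<open>The index \<open>j = k\<close> is missing in the denominator; its factor
    \<open>1 - a * Q powi (2 * k)\<close> moves to the numerator and, with the surviving power,
    forms \<open>Q powi (- k) - a * Q powi k\<close>.\<close>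
  have "(1 - a * Q powi (2 * k)) * (\<Prod>j\<in>I-{k}. 1 - a * Q powi (k + j)) = (\<Prod>j\<in>I. 1 - a * Q powi (k + j))"
    using I by (simp add: prod.remove[of I k])
  also note plus
  finally have r: "(\<Prod>j\<in>I-{k}. 1 - a * Q powi (k + j)) = (1 - a) * H a / (1 - a * Q powi (2 * k))"
    using a2 by (simp add: field_simps)
  have den: "(\<Prod>j\<in>I-{k}. node k - node j) =
     (Q powi (-k)) ^ card (I - {k}) * (H 1 * ((1 - a) * H a / (1 - a * Q powi (2 * k))))"
  proof -
    have "(\<Prod>j\<in>I-{k}. 1 - Q powi (k - j)) = H 1"
      unfolding H_def I_def J_def mult_1 by (rule prod_window_minus_remove)
    thus ?thesis by (simp only: node_minus_node prod.distrib prod_constant r)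
  qed
  have w: "window N k = (1 - \<beta>) * (1 - a / \<beta>) / (1 - a) * (H \<beta> * H (a / \<beta>) / (H 1 * H a))"
    by (simp add: window_def theta_quot_def prod.distrib prod_dividef H_def J_def)
  have e: "Q powi (-k) - a * Q powi k = Q powi (-k) * (1 - a * Q powi (2 * k))"
    by (simp add: power_int_minus right_diff_distrib Q_powi_add[of k k, simplified mult_2[symmetric]])
  have "(\<Prod>j\<in>I. node k - zero_node j) / (\<Prod>j\<in>I-{k}. node k - node j) =
      (Q powi (-k) - a * Q powi k) * window N k"
  proof -
    have "x * y * (b1 * h * (b2 * h')) / (y * (h1 * (a' * ha / d))) = x * d * (b1 * b2 / a' * (h * h' / (h1 * ha)))"
      if "y \<noteq> 0" "d \<noteq> 0" "a' \<noteq> 0" "h1 \<noteq> 0" "ha \<noteq> 0" for x y b1 h b2 h' h1 a' ha d :: complex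
      using that by (simp add: field_simps)
    thus ?thesis unfolding num den w e c using H1 Ha a1 a2 by simp
  qed
  thus ?thesis by (simp add: I_def)
qed

lemma qpoch_inf_nonzeros:
  "qpoch_inf Q q \<noteq> 0"
  "qpoch_inf (a * Q) q \<noteq> 0" "qpoch_inf (Q / a) q \<noteq> 0"
  "qpoch_inf (\<beta> * Q) q \<noteq> 0" "qpoch_inf (Q / \<beta>) q \<noteq> 0"
  "qpoch_inf (a / \<beta> * Q) q \<noteq> 0" "qpoch_inf (Q / (a / \<beta>)) q \<noteq> 0"
proof -
  show "qpoch_inf Q q \<noteq> 0"
    by (rule qpoch_inf_nonzero, unfold Q_times_Q_powi Q_powi_eq_1_iff) simp
qed (use qpoch_inf_powi_nonzero[OF a_generic, of 1] qpoch_inf_powi_nonzero[OF generic_inverse[OF a_generic], of 1]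
      qpoch_inf_powi_nonzero[OF beta_generic, of 1] qpoch_inf_powi_nonzero[OF generic_inverse[OF beta_generic], of 1]
      qpoch_inf_powi_nonzero[OF a_over_beta_generic, of 1] qpoch_inf_powi_nonzero[OF generic_inverse[OF a_over_beta_generic], of 1] in \<open>simp_all add: mult.commute\<close>)

lemma window_lim_nz: "window_lim \<noteq> 0"
  using qpoch_inf_nonzeros a_generic[of 0] beta_generic[of 0] a_over_beta_generic[of 0] unfolding window_lim_def by simp

text \<open>Once N is at least the modulus of \<open>k\<close>, the window is the range from -(N -
  k) to N + k, whose ends both recede to infinity; the limit therefore does not depend on
  \<open>k\<close>.\<close>

lemma window_tendsto: "(\<lambda>N. window N k) \<longlonglongrightarrow> window_lim"
proof -
  have "(\<lambda>N. (1 - \<beta>) * (1 - a / \<beta>) / (1 - a) *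
     (\<Prod>i\<in>{- int (nat (int N - k))..int (nat (int N + k))} - {0}. theta_quot \<beta> (a / \<beta>) 1 a i)) \<longlonglongrightarrow> window_lim"
    unfolding window_lim_def
  proof (intro tendsto_mult[OF tendsto_const] theta_quot_bilateral_tendsto)
    show "filterlim (\<lambda>N. nat (int N - k)) at_top sequentially"
      unfolding filterlim_at_top
    proof
      fix Z show "\<forall>\<^sub>F N in sequentially. Z \<le> nat (int N - k)"
        using eventually_ge_at_top[of "Z + nat \<bar>k\<bar>"] by eventually_elim auto
    qed
    show "filterlim (\<lambda>N. nat (int N + k)) at_top sequentially"
      unfolding filterlim_at_top
    proof
      fix Z show "\<forall>\<^sub>F N in sequentially. Z \<le> nat (int N + k)"
        using eventually_ge_at_top[of "Z + nat \<bar>k\<bar>"] by eventually_elim auto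
    qed
  qed (use a_nz beta_nz qpoch_inf_nonzeros in auto)
  moreover have "\<forall>\<^sub>F N in sequentially. (1 - \<beta>) * (1 - a / \<beta>) / (1 - a) *
     (\<Prod>i\<in>{- int (nat (int N - k))..int (nat (int N + k))} - {0}. theta_quot \<beta> (a / \<beta>) 1 a i) = window N k"
    using eventually_ge_at_top[of "nat \<bar>k\<bar>"]
  proof eventually_elim
    case (elim N)
    hence "- int (nat (int N - k)) = k - int N" "int (nat (int N + k)) = k + int N" by auto
    thus ?case by (simp only: window_def)
  qed
  ultimately show ?thesis by (rule Lim_transform_eventually)
qed

text \<open>The window product splits into partial products, of lengths N + k and N - k, of two
  fixed convergent products. Convergent sequences are bounded, so the bound is uniform in
  \<open>k\<close> and \<open>N\<close>.\<close>

lemma window_bounded: "\<exists>C. \<forall>N k. k \<in> {-int N..int N} \<longrightarrow> norm (window N k) \<le> C"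
proof -
  define U where "U n = (\<Prod>j<n. theta_quot \<beta> (a / \<beta>) 1 a (int (Suc j)))" for n
  define V where "V n = (\<Prod>j<n. theta_quot (1 / \<beta>) (1 / (a / \<beta>)) (1 / 1) (1 / a) (int (Suc j)))" for n
  have "convergent U"
    unfolding U_def convergent_def by (rule exI, rule theta_quot_half_tendsto) (use qpoch_inf_nonzeros in auto)
  moreover have "convergent V"
    unfolding V_def convergent_def by (rule exI, rule theta_quot_half_tendsto) (use qpoch_inf_nonzeros in auto)
  ultimately obtain CU CV where C: "\<And>n. norm (U n) \<le> CU" "\<And>n. norm (V n) \<le> CV"
    by (meson Bseq_def convergent_imp_Bseq)
  have reflect: "theta_quot \<beta> (a / \<beta>) 1 a (- i) = theta_quot (1 / \<beta>) (1 / (a / \<beta>)) (1 / 1) (1 / a) i" for i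
    using a_nz beta_nz by (intro theta_quot_minus) auto
  have "norm (window N k) \<le> norm ((1 - \<beta>) * (1 - a / \<beta>) / (1 - a)) * (CU * CV)"
    if "k \<in> {-int N..int N}" for N k
  proof -
    have e: "{k - int N..k + int N} = {- int (nat (int N - k))..int (nat (int N + k))}"
      using that by auto
    have "window N k = (1 - \<beta>) * (1 - a / \<beta>) / (1 - a) * (U (nat (int N + k)) * V (nat (int N - k)))"
      unfolding window_def e prod_bilateral_split reflect U_def V_def ..
    also have "norm \<dots> = norm ((1 - \<beta>) * (1 - a / \<beta>) / (1 - a)) *
        (norm (U (nat (int N + k))) * norm (V (nat (int N - k))))"
      by (simp only: norm_mult)
    also have "\<dots> \<le> norm ((1 - \<beta>) * (1 - a / \<beta>) / (1 - a)) * (CU * CV)"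
      by (intro mult_mono mult_left_mono C) (auto intro: order_trans[OF norm_ge_zero C(1)])
    finally show ?thesis .
  qed
  thus ?thesis by blast
qed

section \<open>From finite sums over nodes to bilateral sums\<close>

lemma window_sum_tendsto:
  assumes "(\<lambda>k. norm (e k)) summable_on UNIV"
  shows "(\<lambda>N. \<Sum>k\<in>{-int N..int N}. window N k * e k) \<longlonglongrightarrow> window_lim * (\<Sum>\<^sub>\<infinity>k. e k)"
proof -
  obtain C where C: "\<And>N k. k \<in> {-int N..int N} \<Longrightarrow> norm (window N k) \<le> C"
    using window_bounded by blast
  \<comment> \<open>Extension by 0 outside the range turns the finite sums into sums over all
    integers, dominated by \<open>C * norm (e k)\<close>.\<close>
  define f where "f k N = (if k \<in> {-int N..int N} then window N k * e k else 0)" for k N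
  have C0: "C \<ge> 0" using order_trans[OF norm_ge_zero C[of 0 0]] by simp
  have "(\<lambda>N. \<Sum>\<^sub>\<infinity>k. f k N) \<longlonglongrightarrow> (\<Sum>\<^sub>\<infinity>k. window_lim * e k)"
  proof (rule tannery_infsum)
    fix k
    have "(\<lambda>N. window N k * e k) \<longlonglongrightarrow> window_lim * e k"
      by (intro tendsto_intros window_tendsto)
    moreover have "\<forall>\<^sub>F N in sequentially. window N k * e k = f k N"
      using eventually_ge_at_top[of "nat \<bar>k\<bar>"] by eventually_elim (auto simp: f_def)
    ultimately show "(\<lambda>N. f k N) \<longlonglongrightarrow> window_lim * e k"
      by (rule Lim_transform_eventually)
  next
    fix k N
    show "norm (f k N) \<le> C * norm (e k)"
      using C[of k N] C0 by (auto simp: f_def norm_mult intro!: mult_right_mono)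
  next
    show "(\<lambda>k. C * norm (e k)) summable_on UNIV"
      using assms by (rule summable_on_cmult_right)
  qed
  moreover have "(\<Sum>\<^sub>\<infinity>k. f k N) = (\<Sum>k\<in>{-int N..int N}. window N k * e k)" for N
  proof -
    have "(\<Sum>\<^sub>\<infinity>k. f k N) = (\<Sum>\<^sub>\<infinity>k\<in>{-int N..int N}. f k N)"
      by (rule infsum_cong_neutral) (auto simp: f_def)
    also have "\<dots> = (\<Sum>k\<in>{-int N..int N}. window N k * e k)"
      by (simp add: f_def)
    finally show ?thesis .
  qed
  ultimately show ?thesis by (simp add: infsum_cmult_right')
qed

text \<open>The poles \<sigma>(\<beta> q^i) with 0 \<le> i \<le> L are, for N \<ge> L, all zeros of
  the numerator of the residue function. What remains has degree at most deg p + 2N - L < 2N,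
  against 2N + 1 nodes, so each such finite sum vanishes.\<close>

lemma sum_nodes_eq_0:
  fixes L :: nat
  assumes deg: "degree p < L"
  defines "e \<equiv> (\<lambda>k. (Q powi (-k) - a * Q powi k) * poly p (node k) / (\<Prod>i\<le>L. node k - zero_node (- int i)))"
  assumes sum: "(\<lambda>k. norm (e k)) summable_on UNIV"
  shows "(\<Sum>\<^sub>\<infinity>k. e k) = 0"
proof -
  have "(\<Sum>k\<in>{-int N..int N}. window N k * e k) = 0" if N: "N \<ge> L" for N
  proof -
    define I where "I = {-int N..int N}"
    \<comment> \<open>\<open>A\<close> indexes the zeros that are cancelled; \<open>P\<close> below
      is \<open>p\<close> times the linear factors of the remaining ones.\<close>
    define A where "A = (\<lambda>i. - int i) ` {..L}"
    have injA: "inj_on (\<lambda>i. - int i) {..L}" by (auto simp: inj_on_def)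
    have A: "A \<subseteq> I" "finite A" "card A = L + 1" using N
      by (auto simp: A_def I_def card_image[OF injA])
    have I: "finite I" "card I = 2 * N + 1" by (auto simp: I_def)
    define P where "P = p * (\<Prod>j\<in>I-A. [:- zero_node j, 1:])"
    have "degree P \<le> degree p + degree (\<Prod>j\<in>I-A. [:- zero_node j, 1:])"
      unfolding P_def by (rule degree_mult_le)
    also have "degree (\<Prod>j\<in>I-A. [:- zero_node j, 1:]) = (\<Sum>j\<in>I-A. degree [:- zero_node j, 1:])"
      by (rule degree_prod_eq_sum_degree) auto
    also have "\<dots> = 2 * N - L" using A I by (simp add: card_Diff_subset)
    finally have "degree P + 1 < card I" using deg N I by simp
    hence z: "(\<Sum>k\<in>I. poly P (node k) / (\<Prod>j\<in>I-{k}. node k - node j)) = 0"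
      by (intro lagrange_sum_eq_0 I inj_on_subset[OF inj_node]) auto
    have "window N k * e k = poly P (node k) / (\<Prod>j\<in>I-{k}. node k - node j)" if k: "k \<in> I" for k
    proof -
      have "(\<Prod>j\<in>I. node k - zero_node j) = (\<Prod>j\<in>A. node k - zero_node j) * (\<Prod>j\<in>I-A. node k - zero_node j)"
        using A I by (metis prod.subset_diff mult.commute)
      moreover have "(\<Prod>j\<in>A. node k - zero_node j) \<noteq> 0"
        using node_minus_zero_node_nz A by simp
      moreover have "(\<Prod>i\<le>L. node k - zero_node (- int i)) = (\<Prod>j\<in>A. node k - zero_node j)"
        unfolding A_def by (simp add: prod.reindex[OF injA])
      moreover have "window N k * e k = (Q powi (-k) - a * Q powi k) * window N k * poly p (node k) /
          (\<Prod>i\<le>L. node k - zero_node (- int i))"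
        by (simp add: e_def)
      ultimately show ?thesis
        using window_eq[of k N, symmetric] k unfolding I_def[symmetric]
        by (simp add: P_def poly_prod)
    qed
    thus ?thesis using z unfolding I_def by simp
  qed
  hence "\<forall>\<^sub>F N in sequentially. 0 = (\<Sum>k\<in>{-int N..int N}. window N k * e k)"
    by (intro eventually_sequentiallyI[of L]) simp
  hence "(\<lambda>N. \<Sum>k\<in>{-int N..int N}. window N k * e k) \<longlonglongrightarrow> 0"
    by (rule Lim_transform_eventually[OF tendsto_const])
  hence "window_lim * (\<Sum>\<^sub>\<infinity>k. e k) = 0"
    using window_sum_tendsto[OF sum] LIMSEQ_unique by blast
  thus ?thesis using window_lim_nz by simp
qed

text \<open>Only the pole \<sigma>(\<beta>), which is \<open>zero_node 0\<close>, is cancelled.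
  Partial fractions at the other pole \<open>\<sigma> B\<close> evaluate the finite sum as a
  product, whose limit is again a theta quotient.\<close>

lemma sum_nodes_eq:
  assumes B: "B \<noteq> 0" "\<And>k. B * Q powi k \<noteq> 1" "\<And>k. a / B * Q powi k \<noteq> 1"
  defines "e \<equiv> (\<lambda>k. (Q powi (-k) - a * Q powi k) / ((node k - \<sigma> \<beta>) * (node k - \<sigma> B)))"
  assumes sum: "(\<lambda>k. norm (e k)) summable_on UNIV"
  shows "window_lim * (\<Sum>\<^sub>\<infinity>k. e k) =
     qpoch_inf (\<beta> / B * Q) q * qpoch_inf (a / (\<beta> * B) * Q) q * qpoch_inf (B / \<beta> * Q) q * qpoch_inf (\<beta> * B / a * Q) q /
     ((1 - B) * (1 - a / B) *
      (qpoch_inf (Q / B) q * qpoch_inf (B * Q) q * qpoch_inf (a / B * Q) q * qpoch_inf (B / a * Q) q))"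
proof -
  have poly_linear: "poly [:- c, 1:] x = x - c" for c x :: complex by simp
  have nzB: "qpoch_inf (Q / B) q \<noteq> 0" "qpoch_inf (B * Q) q \<noteq> 0"
    "qpoch_inf (a / B * Q) q \<noteq> 0" "qpoch_inf (Q / (a / B)) q \<noteq> 0"
    using qpoch_inf_powi_nonzero[OF B(2), of 1] qpoch_inf_powi_nonzero[OF generic_inverse[OF B(2)], of 1]
      qpoch_inf_powi_nonzero[OF B(3), of 1] qpoch_inf_powi_nonzero[OF generic_inverse[OF B(3)], of 1] by (simp_all add: mult.commute)
  have B1: "1 - B \<noteq> 0" "1 - a / B \<noteq> 0" using B(2)[of 0] B(3)[of 0] by auto
  have nodeB: "node k - \<sigma> B \<noteq> 0" for k
    using node_minus_sigma[of B k] B by auto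
  have sB: "\<sigma> B - node j = B * ((1 - 1 / B * Q powi (-j)) * (1 - a / B * Q powi j))" for j
    using sigma_diff[of B "Q powi (-j)"] B(1) by (simp add: node_def power_int_minus field_simps)
  have sZ: "\<sigma> B - zero_node j = B * ((1 - \<beta> / B * Q powi (-j)) * (1 - a / (\<beta> * B) * Q powi j))" for j
    using sigma_diff[of B "\<beta> * Q powi (-j)"] B(1) beta_nz by (simp add: zero_node_def power_int_minus field_simps)
  have main: "(\<Sum>k\<in>{-int N..int N}. window N k * e k) = 1 / ((1 - B) * (1 - a / B)) *
     (\<Prod>i\<in>{-int N..int N}-{0}. theta_quot (\<beta> / B) (a / (\<beta> * B)) (1 / B) (a / B) i)" for N
  proof -
    define I where "I = {-int N..int N}"
    have I: "finite I" "card I = 2 * N + 1" "0 \<in> I" by (auto simp: I_def)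
    define P where "P = (\<Prod>j\<in>I-{0}. [:- zero_node j, 1:])"
    have "degree P = (\<Sum>j\<in>I-{0}. degree [:- zero_node j, 1:])"
      unfolding P_def by (rule degree_prod_eq_sum_degree) auto
    hence "degree P < card I" using I by simp
    hence z: "(\<Sum>k\<in>I. poly P (node k) / (\<Prod>j\<in>I-{k}. node k - node j) / (\<sigma> B - node k))
       = poly P (\<sigma> B) / (\<Prod>j\<in>I. \<sigma> B - node j)"
    proof (rule lagrange_partial_fractions[OF I(1) inj_on_subset[OF inj_node subset_UNIV]])
      show "\<sigma> B \<notin> node ` I" using nodeB by (metis imageE right_minus_eq)
    qed
    \<comment> \<open>The factor \<open>node k - \<sigma> \<beta>\<close> cancels; the sign comes
      from writing \<open>\<sigma> B - node k\<close> for
      \<open>node k - \<sigma> B\<close>.\<close>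
    have "window N k * e k = - (poly P (node k) / (\<Prod>j\<in>I-{k}. node k - node j) / (\<sigma> B - node k))" if k: "k \<in> I" for k
    proof -
      define R where "R = (\<Prod>j\<in>I-{0}. node k - zero_node j)"
      define D where "D = (\<Prod>j\<in>I-{k}. node k - node j)"
      have u: "node k - \<sigma> \<beta> \<noteq> 0"
        using node_minus_zero_node_nz[of k 0] by (simp add: zero_node_def)
      have "(\<Prod>j\<in>I. node k - zero_node j) = (node k - \<sigma> \<beta>) * R"
        using I by (simp add: prod.remove[of I 0] zero_node_def R_def)
      hence "(Q powi (-k) - a * Q powi k) * window N k = (node k - \<sigma> \<beta>) * R / D"
        using window_eq[of k N] k by (simp add: I_def D_def)
      hence "window N k * e k = (node k - \<sigma> \<beta>) * R / D / ((node k - \<sigma> \<beta>) * (node k - \<sigma> B))"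
        by (simp only: e_def times_divide_eq_right mult.commute[of "window N k"])
      also have "\<dots> = R / D / (node k - \<sigma> B)"
        using u by simp
      also have "\<dots> = - (R / D / (\<sigma> B - node k))"
        by (simp only: divide_minus_right[symmetric] minus_diff_eq)
      finally show ?thesis by (simp only: P_def poly_prod R_def D_def poly_linear)
    qed
    hence lhs: "(\<Sum>k\<in>I. window N k * e k) = - (poly P (\<sigma> B) / (\<Prod>j\<in>I. \<sigma> B - node j))"
      using z by (simp add: sum_negf)
    have num: "poly P (\<sigma> B) = (\<Prod>j\<in>I-{0}. \<sigma> B - zero_node j)"
      by (simp add: P_def poly_prod)
    have den: "(\<Prod>j\<in>I. \<sigma> B - node j) = (\<sigma> B - node 0) * (\<Prod>j\<in>I-{0}. \<sigma> B - node j)"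
      using I by (simp add: prod.remove[of I 0])
    \<comment> \<open>Index 0 is absent from the numerator but present in the denominator; its
      factor is split off and absorbs the sign.\<close>
    have head: "- 1 / (\<sigma> B - node 0) = 1 / ((1 - B) * (1 - a / B))"
    proof -
      have "B * (1 - 1 / B) = - (1 - B)" using B(1) by (simp add: right_diff_distrib)
      hence "\<sigma> B - node 0 = - ((1 - B) * (1 - a / B))"
        using sB[of 0] by (simp add: mult.assoc[symmetric] minus_mult_left)
      thus ?thesis by (simp only: minus_divide_divide)
    qed
    \<comment> \<open>The symmetric range allows \<open>j\<close> to be replaced by
      \<open>- j\<close> in half of the factors, so that all of them combine into
      \<open>theta_quot\<close>.\<close>
    have reflect: "(\<Prod>j\<in>I-{0}. 1 - t * Q powi (-j)) = (\<Prod>j\<in>I-{0}. 1 - t * Q powi j)" for t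
      by (rule prod.reindex_bij_witness[of _ uminus uminus]) (auto simp: I_def)
    have "(\<Prod>j\<in>I-{0}. \<sigma> B - zero_node j) / (\<Prod>j\<in>I-{0}. \<sigma> B - node j) =
       (\<Prod>j\<in>I-{0}. 1 - \<beta> / B * Q powi j) * (\<Prod>j\<in>I-{0}. 1 - a / (\<beta> * B) * Q powi j) /
       ((\<Prod>j\<in>I-{0}. 1 - 1 / B * Q powi j) * (\<Prod>j\<in>I-{0}. 1 - a / B * Q powi j))"
      unfolding sB sZ prod.distrib prod_constant reflect using B(1) by simp
    hence quot: "(\<Prod>j\<in>I-{0}. \<sigma> B - zero_node j) / (\<Prod>j\<in>I-{0}. \<sigma> B - node j) =
       (\<Prod>i\<in>I-{0}. theta_quot (\<beta> / B) (a / (\<beta> * B)) (1 / B) (a / B) i)"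
      by (simp only: theta_quot_def prod.distrib prod_dividef)
    have "- (x / (y * z)) = (- 1 / y) * (x / z)" for x y z :: complex by simp
    thus ?thesis unfolding I_def[symmetric] lhs num den head[symmetric] quot[symmetric] .
  qed
  have "(\<lambda>N. \<Sum>k\<in>{-int N..int N}. window N k * e k) \<longlonglongrightarrow> 1 / ((1 - B) * (1 - a / B)) *
    (qpoch_inf (\<beta> / B * Q) q * qpoch_inf (a / (\<beta> * B) * Q) q / (qpoch_inf (1 / B * Q) q * qpoch_inf (a / B * Q) q) *
     (qpoch_inf (Q / (\<beta> / B)) q * qpoch_inf (Q / (a / (\<beta> * B))) q / (qpoch_inf (Q / (1 / B)) q * qpoch_inf (Q / (a / B)) q)))"
    unfolding main
    by (intro tendsto_mult[OF tendsto_const] theta_quot_bilateral_tendsto)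
       (use a_nz beta_nz B(1) nzB in \<open>auto simp: filterlim_ident mult.commute\<close>)
  from LIMSEQ_unique[OF window_sum_tendsto[OF sum] this] show ?thesis
    by (simp add: mult_ac)
qed

end

section \<open>The functions of the theorem\<close>

lemma summable_on_int:
  fixes f :: "int \<Rightarrow> 'a :: banach"
  assumes "summable (\<lambda>n. norm (f (int n)))" "summable (\<lambda>n. norm (f (- int n)))"
  shows "(\<lambda>k. norm (f k)) summable_on UNIV"
proof -
  have *: "(\<lambda>k. norm (f k)) summable_on range h"
    if "summable (\<lambda>n. norm (f (h n)))" "inj h" for h :: "nat \<Rightarrow> int"
    using norm_summable_imp_summable_on[of "\<lambda>n. norm (f (h n))"] that
    by (subst summable_on_reindex) (auto simp: o_def)
  have "(\<lambda>k. norm (f k)) summable_on (range int \<union> (range (\<lambda>n. - int n) - range int))"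
    by (intro summable_on_Un_disjoint *[OF assms(1)] summable_on_subset_banach[OF *[OF assms(2)]])
       (auto simp: inj_def)
  also have "range int \<union> (range (\<lambda>n. - int n) - range int) = UNIV"
    by (auto simp: image_iff) (metis int_cases2)
  finally show ?thesis .
qed

lemma summable_norm_ratio_tendsto:
  fixes u \<rho> :: "nat \<Rightarrow> complex"
  assumes "\<And>n. u (Suc n) = u n * \<rho> n" "\<rho> \<longlonglongrightarrow> l" "norm l < 1"
  shows "summable (\<lambda>n. norm (u n))"
proof -
  obtain d where d: "norm l < d" "d < 1" using assms(3) dense by blast
  have "\<forall>\<^sub>F n in sequentially. norm (\<rho> n) < d"
    using tendsto_norm[OF assms(2)] d(1) by (rule order_tendstoD)
  then obtain n0 where n0: "\<And>n. n \<ge> n0 \<Longrightarrow> norm (\<rho> n) < d"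
    by (auto simp: eventually_sequentially)
  show ?thesis
  proof (rule summable_ratio_test[OF d(2)])
    fix n assume "n \<ge> n0"
    thus "norm (norm (u (Suc n))) \<le> d * norm (norm (u n))"
      using mult_left_mono[OF less_imp_le[OF n0] norm_ge_zero[of "u n"], of n]
      by (simp add: assms(1) norm_mult mult.commute)
  qed
qed

lemma int_shift_invariant:
  fixes f :: "int \<Rightarrow> 'a"
  assumes "\<And>k. f (k + 1) = f k"
  shows "f n = f 0"
proof (induction n rule: int_induct[of _ 0])
  case (step1 i) thus ?case using assms[of i] by simp
next
  case (step2 i) thus ?case using assms[of "i - 1"] by simp
qed simp

text \<open>Supplies the genericity of \<open>a\<close> and of \<open>b * c / a\<close>, both
  negative reals because \<open>g\<close> is purely imaginary and \<open>c = cnj b\<close>.\<close>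

lemma minus_of_real_neq_1: "- complex_of_real x \<noteq> 1" if "x \<ge> 0"
  using that by (auto simp: complex_eq_iff)

section \<open>Parameters of the theorem: reality and genericity\<close>

locale F_family = nome +
  fixes r g b c :: complex
  assumes r: "r\<^sup>2 = Q"
    and nonzero: "g \<noteq> 0" "b \<noteq> 0" "c \<noteq> 0"
    and c_def: "c = cnj b" and Re_g: "Re g = 0"
    and b_neq: "\<And>j::int. b \<noteq> complex_of_real (q powi j)"
    and c_neq: "\<And>j::int. c \<noteq> complex_of_real (q powi j)"
    and ab_neq: "\<And>j::int. g\<^sup>2 / b \<noteq> complex_of_real (q powi j)"
    and ac_neq: "\<And>j::int. g\<^sup>2 / c \<noteq> complex_of_real (q powi j)"
begin

definition a :: complex where "a = g\<^sup>2"

lemma a_real: "a = - complex_of_real ((Im g)\<^sup>2)"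
  using Re_g by (simp add: a_def complex_eq_iff power2_eq_square)

lemma a_nonzero: "a \<noteq> 0"
  using nonzero by (simp add: a_def)

lemma cnj_simps: "cnj a = a" "cnj g = - g" "cnj b = c" "cnj c = b"
  using Re_g c_def by (auto simp: a_real complex_eq_iff)

lemma generic_of_neq:
  assumes "\<And>j::int. t \<noteq> complex_of_real (q powi j)"
  shows "t * Q powi k \<noteq> 1"
proof
  assume "t * Q powi k = 1"
  hence "t = Q powi (- k)"
    by (simp add: power_int_minus inverse_eq_divide eq_divide_eq)
  thus False using assms[of "-k"] by simp
qed

lemma b_generic: "b * Q powi k \<noteq> 1" and c_generic: "c * Q powi k \<noteq> 1"
  and ab_generic: "a / b * Q powi k \<noteq> 1" and ac_generic: "a / c * Q powi k \<noteq> 1"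
  using generic_of_neq[of b k] generic_of_neq[of c k] generic_of_neq[of "a / b" k] generic_of_neq[of "a / c" k]
    b_neq c_neq ab_neq ac_neq by (simp_all add: a_def)

lemma a_generic: "a * Q powi k \<noteq> 1"
  using minus_of_real_neq_1[of "(Im g)\<^sup>2 * q powi k"] q_pos by (simp add: a_real)

lemma bc_real: "b * c = complex_of_real ((norm b)\<^sup>2)"
  by (simp only: c_def complex_norm_square)

lemma bc_over_a: "1 - b * c * Q powi k / a \<noteq> 0"
proof -
  have "b * c * Q powi k / a = - complex_of_real ((norm b)\<^sup>2 * q powi k / (Im g)\<^sup>2)"
    by (simp add: bc_real a_real)
  also have "\<dots> \<noteq> 1"
    by (rule minus_of_real_neq_1) (use q_pos in simp)
  finally show ?thesis by simp
qed

lemma one_minus_g: "1 - g * Q powi k \<noteq> 0"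
proof
  assume "1 - g * Q powi k = 0"
  hence "g * complex_of_real (q powi k) = 1" by simp
  moreover have "Re (g * complex_of_real (q powi k)) = 0"
    using Re_g by (simp del: of_real_power_int)
  ultimately show False by (metis one_complex.sel(1) zero_neq_one)
qed

lemma norm_bc: "norm c = norm b"
  by (simp add: c_def)

text \<open>\<open>r\<close> and \<open>Q / r\<close> both have modulus sqrt q; up to a factor of
  modulus 1 they are the limiting ratios of the coefficients at the two ends.\<close>

lemma norm_r: "norm r < 1" "norm (Q / r) < 1" "r \<noteq> 0"
proof -
  have "(norm r)\<^sup>2 = q" using r q_pos by (metis norm_power norm_of_real abs_of_pos)
  hence nr: "norm r = sqrt q" using real_sqrt_unique[of "norm r" q] by simp
  thus "norm r < 1" using q_less_1 by simp
  show "r \<noteq> 0" using nr q_pos by auto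
  have "norm (Q / r) = sqrt q"
    using nr q_pos by (simp add: norm_divide real_div_sqrt)
  thus "norm (Q / r) < 1" using q_less_1 by simp
qed

text \<open>A square root of a positive number is real, whichever sign it has; so
  \<open>r powi k\<close> is its own conjugate.\<close>

lemma cnj_r: "cnj r = r"
proof -
  have "Re r * Im r = 0" using r by (auto simp: complex_eq_iff power2_eq_square)
  moreover have "Re r \<noteq> 0"
  proof
    assume "Re r = 0"
    hence "- (Im r)\<^sup>2 = q" using r by (auto simp: complex_eq_iff power2_eq_square)
    thus False using q_pos zero_le_power2[of "Im r"] by linarith
  qed
  ultimately show ?thesis by (simp add: complex_eq_iff)
qed

section \<open>The coefficients as quotients of infinite products\<close>

definition \<phi> :: "complex \<Rightarrow> int \<Rightarrow> complex" where "\<phi> t k = qpoch_inf (t * Q powi k) q"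

lemma \<phi>_rec: "\<phi> t k = (1 - t * Q powi k) * \<phi> t (k + 1)"
  using qpoch_inf_rec[of "t * Q powi k"] by (simp add: \<phi>_def Q_powi_add mult_ac)

lemma \<phi>_shift: "\<phi> t k = (\<Prod>i<n. 1 - t * Q powi (k + int i)) * \<phi> t (k + int n)"
  using qpoch_inf_shift[of "t * Q powi k" n] by (simp add: \<phi>_def Q_powi_add mult_ac)

lemma \<phi>_ratio:
  assumes "\<phi> t j \<noteq> 0" "j = k + int N"
  shows "\<phi> t k / \<phi> t j = (\<Prod>i<N. 1 - t * Q powi (k + int i))"
    and "\<phi> t j / \<phi> t k = 1 / (\<Prod>i<N. 1 - t * Q powi (k + int i))"
  using \<phi>_shift[of t k N] assms by simp_all

lemmas \<phi>_nz =
  qpoch_inf_powi_nonzero[OF b_generic, folded \<phi>_def] qpoch_inf_powi_nonzero[OF c_generic, folded \<phi>_def]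
  qpoch_inf_powi_nonzero[OF ab_generic, folded \<phi>_def] qpoch_inf_powi_nonzero[OF ac_generic, folded \<phi>_def]

text \<open>The part of \<open>F n k\<close> that depends on neither \<open>n\<close> nor
  \<open>k\<close>.\<close>

definition K :: complex where
  "K = \<phi> b 0 * \<phi> (a / c) 0 / ((1 - g) * \<phi> c 1 * \<phi> (a / b) 1)"

abbreviation F :: "int \<Rightarrow> int \<Rightarrow> complex" where "F \<equiv> F_coeff q r g b c"

lemma F_eq:
  "F n k = K * (1 - g * Q powi k) * (\<phi> c (n + k + 1) / \<phi> b (n + k)) *
     (\<phi> (a / b) (k - n + 1) / \<phi> (a / c) (k - n)) * r powi k"
proof -
  have "qpoch b q (n + k) = \<phi> b 0 / \<phi> b (n + k)"
    "qpoch (g\<^sup>2 / c) q (k - n) = \<phi> (a / c) 0 / \<phi> (a / c) (k - n)"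
    "qpoch (c * Q) q (n + k) = \<phi> c 1 / \<phi> c (n + k + 1)"
    "qpoch (g\<^sup>2 * Q / b) q (k - n) = \<phi> (a / b) 1 / \<phi> (a / b) (k - n + 1)"
    by (simp_all add: qpoch_def \<phi>_def a_def Q_powi_add mult_ac)
  thus ?thesis
    unfolding F_coeff_def K_def using one_minus_g[of 0] by (simp add: field_simps)
qed

lemma K_nonzero: "K \<noteq> 0"
  unfolding K_def using \<phi>_nz one_minus_g[of 0] by auto

lemma F_nonzero: "F n k \<noteq> 0"
  unfolding F_eq using \<phi>_nz one_minus_g K_nonzero norm_r(3) by auto

lemma cnj_\<phi>: "cnj (\<phi> t k) = \<phi> (cnj t) k"
  by (simp add: \<phi>_def cnj_qpoch_inf)

text \<open>Conjugation exchanges \<open>b\<close> with \<open>c\<close> and \<open>a / b\<close>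
  with \<open>a / c\<close> and sends \<open>g\<close> to \<open>- g\<close>. In a product with a
  coefficient \<open>F\<close>, each of the four bases therefore occurs once above and once
  below.\<close>

lemma cnj_F:
  "cnj (F n k) = cnj K * (1 + g * Q powi k) * (\<phi> b (n + k + 1) / \<phi> c (n + k)) *
     (\<phi> (a / c) (k - n + 1) / \<phi> (a / b) (k - n)) * r powi k"
  unfolding F_eq by (simp add: cnj_\<phi> cnj_simps cnj_r)

lemma K_cnj_K: "K * cnj K = (1 - b) * (1 - c) * (1 - a / b) * (1 - a / c) / (1 - a)"
proof -
  have "(1 - g) * (1 + g) = 1 - a"
    by (simp add: a_def algebra_simps power2_eq_square)
  moreover have "\<phi> b 0 = (1 - b) * \<phi> b 1" "\<phi> c 0 = (1 - c) * \<phi> c 1"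
     "\<phi> (a / b) 0 = (1 - a / b) * \<phi> (a / b) 1" "\<phi> (a / c) 0 = (1 - a / c) * \<phi> (a / c) 1"
    using \<phi>_rec[of _ 0] by simp_all
  ultimately show ?thesis
    unfolding K_def using \<phi>_nz by (simp add: cnj_\<phi> cnj_simps)
qed

section \<open>Absolute summability of the coefficients\<close>

lemma F_step:
  "F n (k + 1) = F n k * ((1 - g * Q * Q powi k) / (1 - g * Q powi k) *
     ((1 - b * Q powi n * Q powi k) / (1 - c * Q powi (n + 1) * Q powi k)) *
     ((1 - a / c * Q powi (-n) * Q powi k) / (1 - a / b * Q powi (1 - n) * Q powi k)) * r)"
proof -
  have e: "\<phi> c (n + k + 1) = (1 - c * Q powi (n + 1) * Q powi k) * \<phi> c (n + (k + 1) + 1)"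
    "\<phi> b (n + k) = (1 - b * Q powi n * Q powi k) * \<phi> b (n + (k + 1))"
    "\<phi> (a / b) (k - n + 1) = (1 - a / b * Q powi (1 - n) * Q powi k) * \<phi> (a / b) (k + 1 - n + 1)"
    "\<phi> (a / c) (k - n) = (1 - a / c * Q powi (-n) * Q powi k) * \<phi> (a / c) (k + 1 - n)"
    using \<phi>_rec[of c "n + k + 1"] \<phi>_rec[of b "n + k"] \<phi>_rec[of "a / b" "k - n + 1"] \<phi>_rec[of "a / c" "k - n"]
    by (simp_all add: mult.assoc Q_powi_add[symmetric] algebra_simps)
  have nz: "1 - c * Q powi (n + 1) * Q powi k \<noteq> 0" "1 - b * Q powi n * Q powi k \<noteq> 0"
    "1 - a / b * Q powi (1 - n) * Q powi k \<noteq> 0" "1 - a / c * Q powi (-n) * Q powi k \<noteq> 0"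
    using c_generic[of "n + 1 + k"] b_generic[of "n + k"] ab_generic[of "1 - n + k"] ac_generic[of "- n + k"]
    unfolding Q_powi_add by (simp_all only: mult.assoc) auto
  have r1: "r powi (k + 1) = r powi k * r"
    using norm_r(3) by (simp add: power_int_add)
  have g1: "1 - g * Q powi (k + 1) = 1 - g * Q * Q powi k"
    by (simp add: Q_powi_add)
  have alg: "K' * g2 * (c2 / b2) * (ab2 / ac2) * (rk * r) =
     K' * g1 * (xc * c2 / (xb * b2)) * (xab * ab2 / (xac * ac2)) * rk * (g2 / g1 * (xb / xc) * (xac / xab) * r)"
    if "g1 \<noteq> 0" "xc \<noteq> 0" "xb \<noteq> 0" "xab \<noteq> 0" "xac \<noteq> 0"
    for K' g1 g2 c2 b2 ab2 ac2 rk xc xb xab xac :: complex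
    using that by simp
  show ?thesis
    unfolding F_eq e r1 g1 by (rule alg) (use nz one_minus_g in auto)
qed

lemma Q_power_tendsto: "(\<lambda>n. Q ^ n) \<longlonglongrightarrow> 0"
  using q_pos q_less_1 by (intro LIMSEQ_power_zero) simp

lemma F_summable: "(\<lambda>k. norm (F n k)) summable_on UNIV"
proof (rule summable_on_int)
  \<comment> \<open>The ratio of consecutive coefficients as a function of x = q^k; as k grows, x
    tends to 0 and the ratio to \<open>r\<close>.\<close>
  let ?\<rho> = "\<lambda>x. (1 - g * Q * x) / (1 - g * x) *
     ((1 - b * Q powi n * x) / (1 - c * Q powi (n + 1) * x)) *
     ((1 - a / c * Q powi (-n) * x) / (1 - a / b * Q powi (1 - n) * x)) * r"
  show "summable (\<lambda>k. norm (F n (int k)))"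
  proof (rule summable_norm_ratio_tendsto)
    fix k show "F n (int (Suc k)) = F n (int k) * ?\<rho> (Q ^ k)"
      using F_step[of n "int k"] by (simp add: add.commute)
    have one: "(\<lambda>k. 1 - t * Q ^ k) \<longlonglongrightarrow> 1" for t
      using tendsto_diff[OF tendsto_const tendsto_mult[OF tendsto_const Q_power_tendsto], of 1 t] by simp
    show "(\<lambda>k. ?\<rho> (Q ^ k)) \<longlonglongrightarrow> 1 / 1 * (1 / 1) * (1 / 1) * r"
      by (intro tendsto_mult tendsto_divide tendsto_const one) auto
  qed (use norm_r in simp)
  \<comment> \<open>The reciprocal of \<open>?\<rho>\<close> at x = 1/y, with every factor
    multiplied by y so that the limit y = 0 can be taken at the negative end.\<close>
  let ?\<tau> = "\<lambda>y. (y - g) / (y - g * Q) *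
     ((y - c * Q powi (n + 1)) / (y - b * Q powi n)) *
     ((y - a / b * Q powi (1 - n)) / (y - a / c * Q powi (-n))) / r"
  show "summable (\<lambda>k. norm (F n (- int k)))"
  proof (rule summable_norm_ratio_tendsto)
    fix k
    \<comment> \<open>Going from \<open>- k\<close> down to \<open>- k - 1\<close> inverts the ratio
      taken at index \<open>- k - 1\<close>, hence the exponent \<open>k + 1\<close>.\<close>
    define y where "y = Q powi (int k + 1)"
    have y: "y \<noteq> 0" by (simp add: y_def)
    have Qy: "Q powi (- int k - 1) = 1 / y"
      unfolding y_def by (simp add: power_int_minus[symmetric] divide_inverse)
    have r0: "?\<rho> (1 / y) * ?\<tau> y = 1"
    proof -
      have sc: "1 - t * (1 / y) = (y - t) / y" for t
        using y by (simp add: field_simps)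
      have nz: "1 - t * (1 / y) \<noteq> 0 \<Longrightarrow> y - t \<noteq> 0" for t using y by auto
      have pw: "Q powi (j + (- int k - 1)) = Q powi j * (1 / y)" for j
        unfolding Q_powi_add[of j "- int k - 1"] Qy ..
      have gen: "1 - b * Q powi j \<noteq> 0" "1 - c * Q powi j \<noteq> 0"
        "1 - a / b * Q powi j \<noteq> 0" "1 - a / c * Q powi j \<noteq> 0" for j
        using b_generic[of j] c_generic[of j] ab_generic[of j] ac_generic[of j]
        by (metis right_minus_eq)+
      have nzs: "y - g * Q \<noteq> 0" "y - g \<noteq> 0" "y - b * Q powi n \<noteq> 0" "y - c * Q powi (n + 1) \<noteq> 0"
        "y - a / c * Q powi (-n) \<noteq> 0" "y - a / b * Q powi (1 - n) \<noteq> 0"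
        using nz[of "g * Q"] nz[of g] nz[of "b * Q powi n"] nz[of "c * Q powi (n + 1)"]
          nz[of "a / c * Q powi (-n)"] nz[of "a / b * Q powi (1 - n)"]
          one_minus_g[of "1 + (- int k - 1)"] one_minus_g[of "0 + (- int k - 1)"]
          gen(1)[of "n + (- int k - 1)"] gen(2)[of "n + 1 + (- int k - 1)"]
          gen(4)[of "- n + (- int k - 1)"] gen(3)[of "1 - n + (- int k - 1)"]
        by (simp_all only: pw mult.assoc power_int_1_right power_int_0_right mult_1 not_False_eq_True)
      show ?thesis unfolding sc using y nzs norm_r(3) by simp
    qed
    have i: "- int k - 1 + 1 = - int k" "- int (Suc k) = - int k - 1" by auto
    have "F n (- int k) = F n (- int (Suc k)) * ?\<rho> (1 / y)"
      using F_step[of n "- int k - 1"] by (simp only: Qy i)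
    hence "F n (- int (Suc k)) = F n (- int k) * ?\<tau> y"
      using r0 by (simp only: mult.assoc) simp
    thus "F n (- int (Suc k)) = F n (- int k) * ?\<tau> (Q * Q ^ k)"
      by (simp add: y_def Q_powi_add mult_ac)
    have minus: "(\<lambda>k. Q * Q ^ k - t) \<longlonglongrightarrow> - t" for t
      using tendsto_diff[OF tendsto_mult[OF tendsto_const Q_power_tendsto] tendsto_const, of Q t] by simp
    show "(\<lambda>k. ?\<tau> (Q * Q ^ k)) \<longlonglongrightarrow> (- g) / (- (g * Q)) *
     ((- (c * Q powi (n + 1))) / (- (b * Q powi n))) *
     ((- (a / b * Q powi (1 - n))) / (- (a / c * Q powi (-n)))) / r"
      by (intro tendsto_mult tendsto_divide tendsto_const minus) (use nonzero a_nonzero norm_r in auto)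
  next
    \<comment> \<open>The limit is (c/b)^2 Q/r; since b and c have equal modulus, its modulus is
      that of Q/r.\<close>
    have "Q powi (n + 1) = Q * Q powi n" "Q powi (1 - n) = Q * Q powi (- n)"
      using Q_powi_add[of 1 "-n"] by (simp_all add: Q_powi_add)
    hence "(- g) / (- (g * Q)) * ((- (c * Q powi (n + 1))) / (- (b * Q powi n))) *
     ((- (a / b * Q powi (1 - n))) / (- (a / c * Q powi (-n)))) / r = (c / b)\<^sup>2 * (Q / r)"
      using nonzero a_nonzero norm_r(3) by (simp add: power2_eq_square)
    thus "norm ((- g) / (- (g * Q)) * ((- (c * Q powi (n + 1))) / (- (b * Q powi n))) *
     ((- (a / b * Q powi (1 - n))) / (- (a / c * Q powi (-n)))) / r) < 1"
      using norm_r nonzero by (simp only: norm_mult norm_power norm_divide norm_bc) simp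
  qed
qed

section \<open>Products of coefficients and orthogonality\<close>

lemma F_product_summable: "(\<lambda>k. norm (F n k * cnj (F m k))) summable_on UNIV"
proof -
  obtain C where C: "\<And>k. norm (F m k) \<le> C"
  proof
    fix k
    show "norm (F m k) \<le> (\<Sum>\<^sub>\<infinity>k. norm (F m k))"
      using finite_sum_le_infsum[OF F_summable[of m], of "{k}"] by simp
  qed
  show ?thesis
  proof (rule summable_on_comparison_test)
    show "(\<lambda>k. norm (F n k) * C) summable_on UNIV"
      using F_summable by (rule summable_on_cmult_left)
    show "norm (F n k * cnj (F m k)) \<le> norm (F n k) * C" for k
      by (simp add: norm_mult mult_left_mono C)
  qed auto
qed

text \<open>The four quotients are grouped by base; in each the two indices differ, up to sign, by n
  - m + 1 or n - m - 1, so the infinite products reduce to finite ones.\<close>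

lemma F_product:
  "F n k * cnj (F m k) = K * cnj K * ((1 - a * Q powi (2 * k)) * Q powi k) *
     (\<phi> c (n + k + 1) / \<phi> c (m + k)) * (\<phi> b (m + k + 1) / \<phi> b (n + k)) *
     (\<phi> (a / b) (k - n + 1) / \<phi> (a / b) (k - m)) * (\<phi> (a / c) (k - m + 1) / \<phi> (a / c) (k - n))"
proof -
  have "(1 - g * Q powi k) * (1 + g * Q powi k) = 1 - a * Q powi (2 * k)"
    by (simp add: a_def algebra_simps power2_eq_square Q_powi_add[symmetric])
  moreover have "r powi k * r powi k = Q powi k"
    using r by (simp add: power_int_mult_distrib[symmetric] power2_eq_square)
  ultimately have *: "(1 - a * Q powi (2 * k)) * Q powi k =
    ((1 - g * Q powi k) * (1 + g * Q powi k)) * (r powi k * r powi k)" by simp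
  show ?thesis unfolding F_eq[of n] cnj_F * by (simp add: mult_ac)
qed

lemma theta_nodes_shift: "theta_nodes q a (c * Q powi m)"
proof
  show "a \<noteq> 0" "c * Q powi m \<noteq> 0" using a_nonzero nonzero by auto
  fix k
  show "a * Q powi k \<noteq> 1" by (rule a_generic)
  show "c * Q powi m * Q powi k \<noteq> 1"
    using c_generic[of "m + k"] by (simp add: Q_powi_add mult.assoc)
  show "a / (c * Q powi m) * Q powi k \<noteq> 1"
    using ac_generic[of "k - m"] by (simp add: power_int_diff)
qed

lemma weight_eq: "Q powi (- k) - a * Q powi k = Q powi (- k) * (1 - a * Q powi (2 * k))"
  by (simp add: right_diff_distrib power_int_minus Q_powi_add[of k k, simplified mult_2[symmetric]])

text \<open>With L = n - m, the bases \<open>c\<close> and \<open>a / c\<close> give L + 1 poles in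
  the variable \<open>node k\<close>, and \<open>b\<close> and \<open>a / b\<close> give L - 1
  zeros. This is the degree gap that \<open>sum_nodes_eq_0\<close> asks for.\<close>

lemma F_orthogonal_gt:
  assumes "m < n"
  shows "(\<Sum>\<^sub>\<infinity>k. F n k * cnj (F m k)) = 0"
proof -
  define L where "L = nat (n - m)"
  have L: "L \<ge> 1" "n = m + int L" using assms by (auto simp: L_def)
  interpret theta_nodes q a "c * Q powi m" by (rule theta_nodes_shift)
  define p where "p = (\<Prod>i<L-1. [:- \<sigma> (b * Q powi (m + 1 + int i)), 1:])"
  define C where "C = K * cnj K"
  have C0: "C \<noteq> 0" using K_nonzero by (simp add: C_def)
  have "degree p = (\<Sum>i<L-1. degree [:- \<sigma> (b * Q powi (m + 1 + int i)), 1:])"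
    unfolding p_def by (rule degree_prod_eq_sum_degree) auto
  hence deg: "degree p < L" using L by simp
  define e where "e = (\<lambda>k. (Q powi (-k) - a * Q powi k) * poly p (node k) / (\<Prod>i\<le>L. node k - zero_node (- int i)))"
  have F_e: "F n k * cnj (F m k) = C * e k" for k
  proof -
    define x where "x = Q powi (- k)"
    have x: "x \<noteq> 0" "x * Q powi k = 1" by (simp_all add: x_def power_int_minus)
    define B1 where "B1 = (\<Prod>i<L-1. 1 - b * Q powi (m + k + 1 + int i))"
    define B2 where "B2 = (\<Prod>i<L-1. 1 - a / b * Q powi (k - n + 1 + int i))"
    define C1 where "C1 = (\<Prod>i<L+1. 1 - c * Q powi (m + k + int i))"
    define C2 where "C2 = (\<Prod>i<L+1. 1 - a / c * Q powi (k - n + int i))"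
    have "C1 \<noteq> 0" "C2 \<noteq> 0" using c_generic ac_generic by (auto simp: C1_def C2_def)
    have r1: "\<phi> c (n + k + 1) / \<phi> c (m + k) = 1 / C1"
      unfolding C1_def by (rule \<phi>_ratio) (use L \<phi>_nz in auto)
    have r2: "\<phi> b (m + k + 1) / \<phi> b (n + k) = B1"
      unfolding B1_def by (rule \<phi>_ratio) (use L \<phi>_nz in auto)
    have r3: "\<phi> (a / b) (k - n + 1) / \<phi> (a / b) (k - m) = B2"
      unfolding B2_def by (rule \<phi>_ratio) (use L \<phi>_nz in auto)
    have r4: "\<phi> (a / c) (k - m + 1) / \<phi> (a / c) (k - n) = 1 / C2"
      unfolding C2_def by (rule \<phi>_ratio) (use L \<phi>_nz in auto)
    \<comment> \<open>Reversing the order brings together the factors with \<open>b\<close> and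
      \<open>a / b\<close> that make up
      \<open>node k - \<sigma> (b * Q powi (m + 1 + int i))\<close>; \<open>C2\<close> is reversed
      below for the same reason.\<close>
    have reflect1: "B2 = (\<Prod>i<L-1. 1 - a / b * Q powi (k - m - 1 - int i))"
    proof -
      have "B2 = (\<Prod>i<L-1. 1 - a / b * Q powi (k - n + 1 + int (L - 1 - Suc i)))"
        unfolding B2_def by (rule prod.nat_diff_reindex[symmetric])
      also have "\<dots> = (\<Prod>i<L-1. 1 - a / b * Q powi (k - m - 1 - int i))"
      proof (rule prod.cong)
        fix i assume "i \<in> {..<L-1}"
        hence "k - n + 1 + int (L - 1 - Suc i) = k - m - 1 - int i" using L by auto
        thus "1 - a / b * Q powi (k - n + 1 + int (L - 1 - Suc i)) = 1 - a / b * Q powi (k - m - 1 - int i)" by (simp only:)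
      qed simp
      finally show ?thesis .
    qed
    have reflect2: "C2 = (\<Prod>i<L+1. 1 - a / c * Q powi (k - m - int i))"
    proof -
      have "C2 = (\<Prod>i<L+1. 1 - a / c * Q powi (k - n + int (L + 1 - Suc i)))"
        unfolding C2_def by (rule prod.nat_diff_reindex[symmetric])
      also have "\<dots> = (\<Prod>i<L+1. 1 - a / c * Q powi (k - m - int i))"
      proof (rule prod.cong)
        fix i assume "i \<in> {..<L+1}"
        hence "k - n + int (L + 1 - Suc i) = k - m - int i" using L by auto
        thus "1 - a / c * Q powi (k - n + int (L + 1 - Suc i)) = 1 - a / c * Q powi (k - m - int i)" by (simp only:)
      qed simp
      finally show ?thesis .
    qed
    have "node k - \<sigma> (b * Q powi (m + 1 + int i)) =
        x * ((1 - b * Q powi (m + k + 1 + int i)) * (1 - a / b * Q powi (k - m - 1 - int i)))" for i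
    proof -
      define M where "M = m + 1 + int i"
      have i: "m + k + 1 + int i = M + k" "k - m - 1 - int i = k - M" by (auto simp: M_def)
      show ?thesis using node_minus_sigma[of "b * Q powi M" k] nonzero
        unfolding i M_def[symmetric] x_def by (simp add: Q_powi_add power_int_diff mult.assoc)
    qed
    hence num: "poly p (node k) = x ^ (L - 1) * (B1 * B2)"
      by (simp add: p_def poly_prod prod.distrib B1_def reflect1)
    have "node k - zero_node (- int i) =
        x * ((1 - c * Q powi (m + k + int i)) * (1 - a / c * Q powi (k - m - int i)))" for i
    proof -
      have "c * Q powi m * Q powi (k - - int i) = c * Q powi (m + k + int i)"
        by (simp add: Q_powi_add mult.assoc)
      moreover have "a / (c * Q powi m) * Q powi (k + - int i) = a / c * Q powi (k - m - int i)"
        by (simp add: power_int_diff)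
      ultimately show ?thesis using node_minus_zero_node[of k "- int i"] by (simp only: x_def)
    qed
    hence den: "(\<Prod>i\<le>L. node k - zero_node (- int i)) = x ^ (L + 1) * (C1 * C2)"
      unfolding lessThan_Suc_atMost[symmetric] by (simp add: prod.distrib C1_def reflect2)
    \<comment> \<open>Two powers of \<open>x\<close> remain in the denominator and the weight
      contributes one above; what is left is \<open>1 / x\<close>, that is
      \<open>Q powi k\<close>.\<close>
    have "x ^ (L + 1) = x ^ (L - 1) * (x * x)"
      using L by (cases L) auto
    hence "e k = (1 - a * Q powi (2 * k)) / x * (B1 * B2) / (C1 * C2)"
      unfolding e_def num den weight_eq x_def[symmetric] using x by simp
    also have "1 / x = Q powi k" using x by (simp add: field_simps)
    hence "(1 - a * Q powi (2 * k)) / x = (1 - a * Q powi (2 * k)) * Q powi k"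
      by (simp add: divide_inverse)
    finally show ?thesis
      unfolding F_product r1 r2 r3 r4 C_def by simp
  qed
  have "(\<lambda>k. norm (C * e k)) summable_on UNIV"
    using F_product_summable[of n m] by (simp add: F_e)
  hence "(\<lambda>k. norm (e k)) summable_on UNIV"
    using C0 by (simp add: norm_mult summable_on_cmult_right')
  hence "(\<Sum>\<^sub>\<infinity>k. e k) = 0"
    using sum_nodes_eq_0[OF deg] unfolding e_def by blast
  thus ?thesis by (simp add: F_e infsum_cmult_right')
qed

text \<open>Exchanging \<open>n\<close> and \<open>m\<close> conjugates the sum, which reduces the
  claim to m < n.\<close>

lemma F_orthogonal:
  assumes "m \<noteq> n"
  shows "(\<Sum>\<^sub>\<infinity>k. F n k * cnj (F m k)) = 0"
proof (cases "m < n")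
  case False
  hence "(\<Sum>\<^sub>\<infinity>k. F m k * cnj (F n k)) = 0" using assms by (intro F_orthogonal_gt) auto
  hence "cnj (\<Sum>\<^sub>\<infinity>k. F m k * cnj (F n k)) = 0" by simp
  thus ?thesis by (simp add: infsum_cnj[symmetric] mult.commute del: infsum_cnj)
qed (rule F_orthogonal_gt)

section \<open>Evaluation of the squared norm\<close>

definition \<Theta> :: "complex \<Rightarrow> complex" where
  "\<Theta> X = (1 - X) * (1 - a / X) * (qpoch_inf (X * Q) q * qpoch_inf (Q / X) q *
      qpoch_inf (a / X * Q) q * qpoch_inf (X / a * Q) q)"

text \<open>With \<theta>(x) = (x, q/x; q)_inf, \<open>\<Theta> X\<close> above is \<theta>(X)
  \<theta>(a/X), while \<open>\<Lambda> Z\<close> is \<theta>(Z/a) without its factor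
  \<open>1 - Z / a\<close>. This missing factor is the source of (1 - bc/a) / (1 - bc q^(2n)/a) in
  the norm.\<close>

definition \<Lambda> :: "complex \<Rightarrow> complex" where
  "\<Lambda> Z = qpoch_inf (a / Z * Q) q * qpoch_inf (Z / a * Q) q"

text \<open>For m = n each of the four quotients is a single factor, and the pole that survives is
  \<sigma>(B) with B = b q^n. The ratios of B and \<beta> = c q^n are free of \<open>n\<close>, so
  \<open>n\<close> stays only in \<open>\<Lambda>\<close> and \<open>\<Theta>\<close>.\<close>

lemma F_norm_sum:
  "(\<Sum>\<^sub>\<infinity>k. F n k * cnj (F n k)) = (1 - b) * (1 - c) * (1 - a / b) * (1 - a / c) *
     (qpoch_inf Q q * qpoch_inf Q q * qpoch_inf (a * Q) q * qpoch_inf (Q / a) q *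
      qpoch_inf (c / b * Q) q * qpoch_inf (b / c * Q) q) *
     (\<Lambda> (b * c * Q powi (2 * n)) / (\<Theta> (b * Q powi n) * \<Theta> (c * Q powi n)))"
proof -
  define \<beta> where "\<beta> = c * Q powi n"
  define B where "B = b * Q powi n"
  interpret theta_nodes q a \<beta> unfolding \<beta>_def by (rule theta_nodes_shift)
  define C where "C = K * cnj K"
  have C0: "C \<noteq> 0" using K_nonzero by (simp add: C_def)
  have B: "B \<noteq> 0" "\<And>k. B * Q powi k \<noteq> 1" "\<And>k. a / B * Q powi k \<noteq> 1"
  proof -
    show "B \<noteq> 0" using nonzero by (simp add: B_def)
    show "B * Q powi k \<noteq> 1" for k
      using b_generic[of "n + k"] by (simp add: B_def Q_powi_add mult.assoc)
    show "a / B * Q powi k \<noteq> 1" for k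
      using ab_generic[of "k - n"] by (simp add: B_def power_int_diff)
  qed
  define e where "e = (\<lambda>k. (Q powi (-k) - a * Q powi k) / ((node k - \<sigma> \<beta>) * (node k - \<sigma> B)))"
  have F_e: "F n k * cnj (F n k) = C * e k" for k
  proof -
    define x where "x = Q powi (- k)"
    have x: "x \<noteq> 0" "x * Q powi k = 1" by (simp_all add: x_def power_int_minus)
    have ratio: "\<phi> t (j + 1) / \<phi> t j = 1 / (1 - t * Q powi j)" if "\<phi> t (j + 1) \<noteq> 0" for t j
      using \<phi>_rec[of t j] that by simp
    have shift: "c * Q powi (n + k) = \<beta> * Q powi k" "b * Q powi (n + k) = B * Q powi k"
      "a / b * Q powi (k - n) = a / B * Q powi k" "a / c * Q powi (k - n) = a / \<beta> * Q powi k"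
      by (simp_all add: \<beta>_def B_def Q_powi_add power_int_diff)
    have nodes: "node k - \<sigma> \<beta> = x * ((1 - \<beta> * Q powi k) * (1 - a / \<beta> * Q powi k))"
      "node k - \<sigma> B = x * ((1 - B * Q powi k) * (1 - a / B * Q powi k))"
      using node_minus_sigma[OF beta_nz, of k] node_minus_sigma[OF B(1), of k] by (simp_all only: x_def)
    have "1 / x = Q powi k" using x by (simp add: field_simps)
    hence "e k = (1 - a * Q powi (2 * k)) * Q powi k / (((1 - \<beta> * Q powi k) * (1 - a / \<beta> * Q powi k)) *
       ((1 - B * Q powi k) * (1 - a / B * Q powi k)))"
      unfolding e_def nodes weight_eq x_def[symmetric] using x by (simp add: divide_inverse mult_ac)
    thus ?thesis
      unfolding F_product ratio[OF \<phi>_nz(1)] ratio[OF \<phi>_nz(2)] ratio[OF \<phi>_nz(3)] ratio[OF \<phi>_nz(4)] shift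
      by (simp add: C_def mult_ac)
  qed
  have "(\<lambda>k. norm (C * e k)) summable_on UNIV"
    using F_product_summable[of n n] by (simp add: F_e)
  hence "(\<lambda>k. norm (e k)) summable_on UNIV"
    using C0 by (simp add: norm_mult summable_on_cmult_right')
  hence S: "window_lim * (\<Sum>\<^sub>\<infinity>k. e k) =
     qpoch_inf (\<beta> / B * Q) q * qpoch_inf (a / (\<beta> * B) * Q) q * qpoch_inf (B / \<beta> * Q) q * qpoch_inf (\<beta> * B / a * Q) q /
     ((1 - B) * (1 - a / B) *
      (qpoch_inf (Q / B) q * qpoch_inf (B * Q) q * qpoch_inf (a / B * Q) q * qpoch_inf (B / a * Q) q))"
    using sum_nodes_eq[OF B] unfolding e_def by blast
  have a1: "1 - a \<noteq> 0" using a_generic[of 0] by simp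
  define N where "N = qpoch_inf Q q * qpoch_inf Q q * qpoch_inf (a * Q) q * qpoch_inf (Q / a) q"
  have N0: "N \<noteq> 0" using qpoch_inf_nonzeros by (simp add: N_def)
  have W: "window_lim = \<Theta> \<beta> / ((1 - a) * N)"
    unfolding window_lim_def \<Theta>_def N_def using beta_nz by (simp add: mult_ac)
  have \<Theta>0: "\<Theta> \<beta> \<noteq> 0" using window_lim_nz unfolding W by auto
  have cancel: "S = D * X / (Y * T)" if "T / D * S = X / Y" "T \<noteq> 0" "D \<noteq> 0" for S D X Y T :: complex
  proof -
    have "S = (T / D * S) * D / T" using that(2,3) by simp
    thus ?thesis unfolding that(1) by simp
  qed
  have "\<beta> * B = b * c * Q powi (2 * n)"
    by (simp add: \<beta>_def B_def Q_powi_add[of n n, simplified mult_2[symmetric]])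
  moreover have "\<beta> / B = c / b" "B / \<beta> = b / c" by (simp_all add: \<beta>_def B_def)
  ultimately have "window_lim * (\<Sum>\<^sub>\<infinity>k. e k) =
     qpoch_inf (c / b * Q) q * qpoch_inf (b / c * Q) q * \<Lambda> (b * c * Q powi (2 * n)) / \<Theta> B"
    unfolding S by (simp add: \<Lambda>_def \<Theta>_def mult_ac)
  hence "(\<Sum>\<^sub>\<infinity>k. e k) = (1 - a) * N * (qpoch_inf (c / b * Q) q * qpoch_inf (b / c * Q) q *
     \<Lambda> (b * c * Q powi (2 * n))) / (\<Theta> B * \<Theta> \<beta>)"
    using cancel[of "\<Theta> \<beta>" "(1 - a) * N"] \<Theta>0 N0 a1 unfolding W by simp
  hence "(\<Sum>\<^sub>\<infinity>k. F n k * cnj (F n k)) = C * ((1 - a) * N * (qpoch_inf (c / b * Q) q * qpoch_inf (b / c * Q) q *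
     \<Lambda> (b * c * Q powi (2 * n))) / (\<Theta> B * \<Theta> \<beta>))"
    by (simp add: F_e infsum_cmult_right')
  thus ?thesis
    unfolding C_def K_cnj_K N_def B_def \<beta>_def using a1 by simp
qed

text \<open>Quasi-periodicity \<theta>(xq) = -\<theta>(x)/x, applied upwards to \<theta>(X) and
  downwards to \<theta>(a/X).\<close>

lemma \<Theta>_step:
  assumes "X \<noteq> 0"
  shows "\<Theta> (X * Q) = a / (Q * X\<^sup>2) * \<Theta> X"
proof -
  have 1: "qpoch_inf (Q / (X * Q)) q = (1 - 1 / X) * qpoch_inf (Q / X) q"
    using qpoch_inf_rec[of "1 / X"] by simp
  have 2: "qpoch_inf (a / (X * Q) * Q) q = (1 - a / X) * qpoch_inf (a / X * Q) q"
    using qpoch_inf_rec[of "a / X"] by simp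
  have 3: "qpoch_inf (X / a * Q) q = (1 - X * Q / a) * qpoch_inf (X * Q / a * Q) q"
    using qpoch_inf_rec[of "X / a * Q"] by simp
  have 4: "qpoch_inf (X * Q) q = (1 - X * Q) * qpoch_inf (X * Q * Q) q"
    by (rule qpoch_inf_rec)
  have 5: "1 - a / (X * Q) = - (a / (X * Q)) * (1 - X * Q / a)" "1 - 1 / X = - (1 / X) * (1 - X)"
    using assms a_nonzero by (simp_all add: right_diff_distrib)
  show ?thesis
    unfolding \<Theta>_def 1 2 3 4 unfolding 5 by (simp add: power2_eq_square mult_ac)
qed

text \<open>Two steps of the quasi-periodicity of \<theta>(Z/a), which is
  \<open>(1 - Z / a) * \<Lambda> Z\<close>; the shift is by q^2 because Z stands for bc
  q^(2n).\<close>

lemma \<Lambda>_step: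
  assumes "Z \<noteq> 0" "1 - Z * Q / a \<noteq> 0"
  shows "\<Lambda> (Z * Q\<^sup>2) * (1 - Z * Q\<^sup>2 / a) = a\<^sup>2 / (Q * Z\<^sup>2) * (1 - Z / a) * \<Lambda> Z"
proof -
  have 1: "qpoch_inf (a / (Z * Q\<^sup>2) * Q) q = (1 - a / (Z * Q)) * ((1 - a / Z) * qpoch_inf (a / Z * Q) q)"
    using qpoch_inf_rec[of "a / (Z * Q)"] qpoch_inf_rec[of "a / Z"] by (simp add: power2_eq_square)
  have 2: "qpoch_inf (Z / a * Q) q = (1 - Z * Q / a) * ((1 - Z * Q\<^sup>2 / a) * qpoch_inf (Z * Q\<^sup>2 / a * Q) q)"
    using qpoch_inf_rec[of "Z / a * Q"] qpoch_inf_rec[of "Z * Q\<^sup>2 / a"] by (simp add: power2_eq_square mult_ac)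
  have 3: "1 - a / (Z * Q) = - (a / (Z * Q)) * (1 - Z * Q / a)" "1 - a / Z = - (a / Z) * (1 - Z / a)"
    using assms a_nonzero by (simp_all add: right_diff_distrib)
  show ?thesis
    unfolding \<Lambda>_def 1 2 unfolding 3 by (simp add: power2_eq_square mult_ac)
qed

lemma \<Theta>_nonzero: "\<Theta> (b * Q powi n) \<noteq> 0" "\<Theta> (c * Q powi n) \<noteq> 0"
proof -
  have *: "\<Theta> (t * Q powi n) \<noteq> 0"
    if t: "\<And>k. t * Q powi k \<noteq> 1" "\<And>k. a / t * Q powi k \<noteq> 1" and "t \<noteq> 0" for t
  proof -
    \<comment> \<open>The locale is entered with a general \<open>t\<close> in place of
      \<open>c\<close>, so that its nonvanishing facts also cover \<open>b\<close>.\<close>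
    have "theta_nodes q a (t * Q powi n)"
    proof
      fix k
      show "a * Q powi k \<noteq> 1" by (rule a_generic)
      show "t * Q powi n * Q powi k \<noteq> 1"
        using t(1)[of "n + k"] by (simp add: Q_powi_add mult.assoc)
      show "a / (t * Q powi n) * Q powi k \<noteq> 1"
        using t(2)[of "k - n"] by (simp add: power_int_diff)
    qed (use a_nonzero \<open>t \<noteq> 0\<close> in auto)
    then interpret theta_nodes q a "t * Q powi n" .
    show ?thesis
      using qpoch_inf_nonzeros(4-) beta_generic[of 0] a_over_beta_generic[of 0] unfolding \<Theta>_def by (simp add: mult.commute)
  qed
  show "\<Theta> (b * Q powi n) \<noteq> 0" "\<Theta> (c * Q powi n) \<noteq> 0"
    using *[OF b_generic ab_generic nonzero(2)] *[OF c_generic ac_generic nonzero(3)] .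
qed

text \<open>With Z = bc q^(2n), raising \<open>n\<close> by one multiplies the theta function above
  by a^2/(q Z^2) and the product of the two \<open>\<Theta>\<close> by a^2/(q^2 Z^2). The ratio q is
  balanced by the division by q^n, so \<open>f\<close> is constant and equals its value at
  0.\<close>

lemma norm_quotient:
  "\<Lambda> (b * c * Q powi (2 * n)) / (\<Theta> (b * Q powi n) * \<Theta> (c * Q powi n)) =
   \<Lambda> (b * c) / (\<Theta> b * \<Theta> c) * ((1 - b * c / a) / (1 - b * c * Q powi (2 * n) / a) * Q powi n)"
proof -
  define f where "f n = \<Lambda> (b * c * Q powi (2 * n)) / (\<Theta> (b * Q powi n) * \<Theta> (c * Q powi n)) *
     ((1 - b * c * Q powi (2 * n) / a) / Q powi n)" for n
  have "f (n + 1) = f n" for n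
  proof -
    define y where "y = Q powi n"
    define Z where "Z = b * c * y\<^sup>2"
    have y: "y \<noteq> 0" by (simp add: y_def)
    have double: "2 * n = n + n" "2 * (n + 1) = (n + n) + (1 + 1)" by auto
    have pw: "Q powi (n + 1) = y * Q" "Q powi (2 * n) = y\<^sup>2" "Q powi (2 * (n + 1)) = y\<^sup>2 * Q\<^sup>2"
      by (simp_all only: double Q_powi_add power_int_1_right y_def power2_eq_square)
    have Z: "Z \<noteq> 0" using nonzero y by (simp add: Z_def)
    have "1 - Z * Q / a \<noteq> 0"
      using bc_over_a[of "2 * n + 1"] by (simp add: Q_powi_add pw Z_def mult.assoc)
    note \<Lambda> = \<Lambda>_step[OF Z this]
    have Z2: "b * c * (y\<^sup>2 * Q\<^sup>2) = Z * Q\<^sup>2" "b * c * y\<^sup>2 = Z" by (simp_all add: Z_def)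
    have \<Theta>b: "\<Theta> (b * (y * Q)) = a / (Q * (b * y)\<^sup>2) * \<Theta> (b * y)"
      and \<Theta>c: "\<Theta> (c * (y * Q)) = a / (Q * (c * y)\<^sup>2) * \<Theta> (c * y)"
      using \<Theta>_step[of "b * y"] \<Theta>_step[of "c * y"] y nonzero by (simp_all add: mult.assoc)
    have \<Theta>0: "\<Theta> (b * y) \<noteq> 0" "\<Theta> (c * y) \<noteq> 0" using \<Theta>_nonzero by (simp_all add: y_def)
    have "f (n + 1) = (\<Lambda> (Z * Q\<^sup>2) * (1 - Z * Q\<^sup>2 / a)) / (\<Theta> (b * (y * Q)) * \<Theta> (c * (y * Q))) / (y * Q)"
      unfolding f_def pw Z2 by simp
    also have "\<dots> = (a\<^sup>2 / (Q * Z\<^sup>2) * (1 - Z / a) * \<Lambda> Z) /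
       ((a / (Q * (b * y)\<^sup>2) * \<Theta> (b * y)) * (a / (Q * (c * y)\<^sup>2) * \<Theta> (c * y))) / (y * Q)"
      unfolding \<Lambda> \<Theta>b \<Theta>c ..
    also have "\<dots> = \<Lambda> Z / (\<Theta> (b * y) * \<Theta> (c * y)) * ((1 - Z / a) / y)"
    proof -
      have "Z\<^sup>2 = (b * y)\<^sup>2 * (c * y)\<^sup>2" by (simp add: Z_def power2_eq_square)
      thus ?thesis using \<Theta>0 y nonzero a_nonzero by (simp add: power2_eq_square) (simp add: mult_ac)
    qed
    also have "\<dots> = f n" by (simp only: f_def pw Z2 y_def[symmetric])
    finally show ?thesis .
  qed
  hence "f n = f 0" by (rule int_shift_invariant)
  hence f_eq: "\<Lambda> (b * c * Q powi (2 * n)) / (\<Theta> (b * Q powi n) * \<Theta> (c * Q powi n)) *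
     ((1 - b * c * Q powi (2 * n) / a) / Q powi n) = \<Lambda> (b * c) / (\<Theta> b * \<Theta> c) * (1 - b * c / a)"
    by (simp add: f_def)
  have "M = M0 * (u / w * y)" if "M * (w / y) = M0 * u" "w \<noteq> 0" "y \<noteq> 0" for M M0 u w y :: complex
  proof -
    have "M = M * (w / y) * (y / w)" using that(2,3) by simp
    thus ?thesis unfolding that(1) by simp
  qed
  from this[OF f_eq bc_over_a Q_powi_nonzero] show ?thesis .
qed

lemma F_norm_eq: "(\<Sum>\<^sub>\<infinity>k. F n k * cnj (F n k)) = F_norm q g b c n"
proof -
  have nz: "1 - b \<noteq> 0" "1 - c \<noteq> 0" "1 - a / b \<noteq> 0" "1 - a / c \<noteq> 0"
    using b_generic[of 0] c_generic[of 0] ab_generic[of 0] ac_generic[of 0] by auto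
  \<comment> \<open>The prefactor of the norm sum cancels the leading factors of
    \<open>\<Theta> b\<close> and \<open>\<Theta> c\<close>, leaving infinite products and the
    factor \<open>w\<close> that contains \<open>n\<close>.\<close>
  have rule: "xb * xc * xab * xac * (q1 * q2 * q3 * q4 * q5 * q6) * (l1 * l2 / (xb * xab * t * (xc * xac * t')) * w)
      = q1 * q2 * q3 * q4 * l1 * l2 * q5 * q6 / (t * t') * w"
    if "xb \<noteq> 0" "xc \<noteq> 0" "xab \<noteq> 0" "xac \<noteq> 0"
    for xb xc xab xac q1 q2 q3 q4 q5 q6 l1 l2 t t' w :: complex
    using that by simp
  show ?thesis
    unfolding F_norm_sum norm_quotient unfolding \<Lambda>_def \<Theta>_def rule[OF nz]
    by (simp add: F_norm_def Let_def qpoch_inf_list_def a_def mult_ac)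
qed

section \<open>Inner products and positivity of the norms\<close>

lemma F_has_sum: "((\<lambda>k. F n k * cnj (F m k)) has_sum (if n = m then F_norm q g b c n else 0)) UNIV"
proof -
  have "(\<lambda>k. F n k * cnj (F m k)) summable_on UNIV"
    using F_product_summable by (rule abs_summable_summable)
  from has_sum_infsum[OF this] show ?thesis
    using F_norm_eq[of n] F_orthogonal[of m n] by auto
qed

text \<open>Reality and positivity are read off the series rather than the product formula: it adds
  up the squared moduli of the coefficients, and the one at k = 0 is nonzero.\<close>

lemma F_norm_positive: "F_norm q g b c n = complex_of_real (Re (F_norm q g b c n))" "0 < Re (F_norm q g b c n)"
proof -
  have "((\<lambda>k. complex_of_real ((norm (F n k))\<^sup>2)) has_sum F_norm q g b c n) UNIV"
    using F_has_sum[of n n] by (simp add: complex_norm_square del: of_real_power)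
  from has_sum_Re[OF this] has_sum_Im[OF this] have Re: "((\<lambda>k. (norm (F n k))\<^sup>2) has_sum Re (F_norm q g b c n)) UNIV"
    and Im: "((\<lambda>k. 0) has_sum Im (F_norm q g b c n)) (UNIV :: int set)"
    by simp_all
  have "Im (F_norm q g b c n) = 0" using infsumI[OF Im] by simp
  thus "F_norm q g b c n = complex_of_real (Re (F_norm q g b c n))"
    by (simp add: complex_eq_iff)
  have "0 < (\<Sum>k\<in>{0}. (norm (F n k))\<^sup>2)" using F_nonzero by simp
  also have "\<dots> \<le> Re (F_norm q g b c n)"
    using Re by (rule finite_sum_le_has_sum) auto
  finally show "0 < Re (F_norm q g b c n)" .
qed

lemma F_orthogonal_functions:
  "orthogonal_functions (\<lambda>z. 1) (F_fun q r g b c) (\<lambda>n. Re (F_norm q g b c n))"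
proof -
  have fourier: "F_fun q r g b c n = (\<lambda>z. \<Sum>\<^sub>\<infinity>k. F n k * z powi k)" for n
    by (rule ext) (simp only: F_fun_def)
  note inner = circle_fourier_inner[OF F_summable F_summable]
  have "circle_inner (\<lambda>z. 1) (F_fun q r g b c n) (F_fun q r g b c m) =
      (if n = m then F_norm q g b c n else 0)" for n m
    unfolding fourier using inner(2)[of n m] F_has_sum[of n m] by (rule has_sum_unique)
  moreover have "circle_integrand (\<lambda>z. 1) (F_fun q r g b c n) (F_fun q r g b c m)
      contour_integrable_on circlepath 0 1" for n m
    unfolding fourier by (rule inner(1))
  ultimately show ?thesis
    unfolding orthogonal_functions_def using F_norm_positive by auto
qed

end

theorem theorem1:
  fixes q :: real and r g b c :: complex
  assumes "0 < q" and "q < 1"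
    and "r\<^sup>2 = complex_of_real q"
    and "g \<noteq> 0" and "b \<noteq> 0" and "c \<noteq> 0"
    and "c = cnj b" and "Re g = 0"
    and "\<And>j::int. b \<noteq> complex_of_real (q powi j)"
    and "\<And>j::int. c \<noteq> complex_of_real (q powi j)"
    and "\<And>j::int. g\<^sup>2 / b \<noteq> complex_of_real (q powi j)"
    and "\<And>j::int. g\<^sup>2 / c \<noteq> complex_of_real (q powi j)"
  shows "(\<forall>n z. norm z = 1 \<longrightarrow> (\<lambda>k. F_coeff q r g b c n k * z powi k) summable_on UNIV) \<and>
         (\<exists>h :: int \<Rightarrow> real.
            (\<forall>n. complex_of_real (h n) = F_norm q g b c n) \<and>
            orthogonal_functions (\<lambda>z. 1) (F_fun q r g b c) h)"
\<comment> \<open>The product formula has real values, so its real part serves as the sequence of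
  squared norms.\<close>
proof (intro conjI allI impI exI[of _ "\<lambda>n. Re (F_norm q g b c n)"])
  have family: "F_family q r g b c"
    by unfold_locales (fact assms)+
  show "orthogonal_functions (\<lambda>z. 1) (F_fun q r g b c) (\<lambda>n. Re (F_norm q g b c n))"
    by (rule F_family.F_orthogonal_functions[OF family])
  fix n
  show "complex_of_real (Re (F_norm q g b c n)) = F_norm q g b c n"
    by (rule F_family.F_norm_positive(1)[OF family, symmetric])
  fix z :: complex assume "norm z = 1"
  hence "(\<lambda>k. norm (F_coeff q r g b c n k * z powi k)) summable_on UNIV"
    using F_family.F_summable[OF family, of n] by (simp add: norm_mult norm_power_int)
  thus "(\<lambda>k. F_coeff q r g b c n k * z powi k) summable_on UNIV"
    by (rule abs_summable_summable)
qed

end
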